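(* Let $S$ be a set of places of $\mathbb{Q}$, let $X$ be the set of places of $\overline{\mathbb{Q}}$ dividing a place in $S$, let $\mathcal J^*$ be the real vector space of consistent maps $c:\mathcal J\to\mathbb{R}$, and let $\mathcal L^*$ be the algebraic dual of $\mathcal L=LC_c(X)$. Then the map $\Phi^*:\mathcal J^*\to\mathcal L^*$, $\Phi^*(c)=\Phi_c$, is a vector space isomorphism of $\mathcal J^*$ onto $\mathcal L^*$.
   Context: Fix an algebraic closure $\overline{\mathbb{Q}}$; number fields lie inside it. For a number field $K$ and place $v$ of $K$, $K_v$ is the completion and $\mathbb{Q}_v$ the completion of $\mathbb{Q}$ at the place below $v$. $Y$ is the set of all places of $\overline{\mathbb{Q}}$ and $Y(K,v)=\{y\in Y:y\mid v\}$; $Y$ has the topology with basis $\{Y(K,v)\}$ ($K$ ranging over number fields, $v$ over places of $K$), and $X\subseteq Y$ the subspace topology. $M_K(S)$ is the set of places of $K$ dividing a place of $S$, and $\mathcal J=\{(K,v): K \text{ a number field},\ v\in M_K(S)\}$. A map $c:\mathcal J\to\mathbb{R}$ is consistent if $c(K,v)=\sum_{w\mid v}c(L,w)$ for all $(K,v)\in\mathcal J$ and all finite extensions $L/K$ (sum over places $w$ of $L$ dividing $v$); these form a real vector space under pointwise operations. $LC_c(X)$ is the real vector space of locally constant, compactly supported functions $X\to\mathbb{R}$. For each $f\in LC_c(X)$ there is a number field $K$ such that $f$ is constant on each $Y(K,v)$, $v\in M_K(S)$, with value (denoted $f(v)$) equal to $0$ for all but finitely many $v$. For consistent $c$, define $\Phi_c(f)=\sum_{v\in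 M_K(S)}c(K,v)f(v)$ for any such $K$; this is independent of the choice of $K$ and $\Phi_c$ is a linear functional on $LC_c(X)$. *)

theory Defs
  imports "HOL-Analysis.Analysis" "HOL-Computational_Algebra.Polynomial"
begin

text \<open>We model the algebraic closure of Q as the set of algebraic complex numbers.
  An absolute value on a subfield F of C is a real function (extended by 0 outside F);
  a place of F is an equivalence class of nontrivial absolute values on F,
  where two absolute values are equivalent iff one is a positive real power of the other.\<close>

type_synonym absval = "complex \<Rightarrow> real"
type_synonym place = "absval set"

definition Qbar :: "complex set" where
  "Qbar = {z. algebraic z}"

definition subfield :: "complex set \<Rightarrow> bool" where
  "subfield F \<longleftrightarrow> 0 \<in> F \<and> 1 \<in> F \<and> (\<forall>x\<in>F. \<forall>y\<in>F. x + y \<in> F \<and> x - y \<in> F \<and> x * y \<in> F)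
     \<and> (\<forall>x\<in>F. x \<noteq> 0 \<longrightarrow> inverse x \<in> F)"

definition rat_span :: "complex set \<Rightarrow> complex set" where
  "rat_span B = {\<Sum>b\<in>B. of_rat (r b) * b | r. True}"

definition number_field :: "complex set \<Rightarrow> bool" where
  "number_field K \<longleftrightarrow> subfield K \<and> K \<subseteq> Qbar \<and> (\<exists>B. finite B \<and> B \<subseteq> K \<and> K \<subseteq> rat_span B)"

definition abs_value :: "complex set \<Rightarrow> absval \<Rightarrow> bool" where
  "abs_value F \<phi> \<longleftrightarrow> (\<forall>x\<in>F. \<phi> x \<ge> 0) \<and> (\<forall>x\<in>F. \<phi> x = 0 \<longleftrightarrow> x = 0)
     \<and> (\<forall>x\<in>F. \<forall>y\<in>F. \<phi> (x * y) = \<phi> x * \<phi> y)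
     \<and> (\<forall>x\<in>F. \<forall>y\<in>F. \<phi> (x + y) \<le> \<phi> x + \<phi> y)
     \<and> (\<forall>x. x \<notin> F \<longrightarrow> \<phi> x = 0)"

definition nontrivial_av :: "complex set \<Rightarrow> absval \<Rightarrow> bool" where
  "nontrivial_av F \<phi> \<longleftrightarrow> (\<exists>x\<in>F. x \<noteq> 0 \<and> \<phi> x \<noteq> 1)"

definition equiv_av :: "complex set \<Rightarrow> absval \<Rightarrow> absval \<Rightarrow> bool" where
  "equiv_av F \<phi> \<psi> \<longleftrightarrow> (\<exists>t>0. \<forall>x\<in>F. \<psi> x = \<phi> x powr t)"

definition places :: "complex set \<Rightarrow> place set" where
  "places F = {{\<psi>. abs_value F \<psi> \<and> equiv_av F \<phi> \<psi>} | \<phi>. abs_value F \<phi> \<and> nontrivial_av F \<phi>}"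

definition restr :: "complex set \<Rightarrow> absval \<Rightarrow> absval" where
  "restr K \<phi> = (\<lambda>x. if x \<in> K then \<phi> x else 0)"

definition divides :: "complex set \<Rightarrow> place \<Rightarrow> place \<Rightarrow> bool" where
  "divides K w v \<longleftrightarrow> (\<exists>\<phi>\<in>w. restr K \<phi> \<in> v)"

definition Yall :: "place set" where
  "Yall = places Qbar"

definition Yset :: "complex set \<Rightarrow> place \<Rightarrow> place set" where
  "Yset K v = {y \<in> Yall. divides K y v}"

definition Xset :: "place set \<Rightarrow> place set" where
  "Xset S = {y \<in> Yall. \<exists>s\<in>S. divides \<rat> y s}"

definition MK :: "place set \<Rightarrow> complex set \<Rightarrow> place set" where
  "MK S K = {v \<in> places K. \<exists>s\<in>S. divides \<rat> v s}"

definition Jset :: "place set \<Rightarrow> (complex set \<times> place) set" where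
  "Jset S = {(K, v). number_field K \<and> v \<in> MK S K}"

definition Ytop :: "place topology" where
  "Ytop = topology_generated_by {Yset K v | K v. number_field K \<and> v \<in> places K}"

definition Xtop :: "place set \<Rightarrow> place topology" where
  "Xtop S = subtopology Ytop (Xset S)"

definition locally_constant :: "place set \<Rightarrow> (place \<Rightarrow> real) \<Rightarrow> bool" where
  "locally_constant S f \<longleftrightarrow>
     (\<forall>x\<in>Xset S. \<exists>U. openin (Xtop S) U \<and> x \<in> U \<and> (\<forall>y\<in>U. f y = f x))"

definition compact_support :: "place set \<Rightarrow> (place \<Rightarrow> real) \<Rightarrow> bool" where
  "compact_support S f \<longleftrightarrow> compactin (Xtop S) ((Xtop S) closure_of {x \<in> Xset S. f x \<noteq> 0})"

definition LCc :: "place set \<Rightarrow> (place \<Rightarrow> real) set" where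
  "LCc S = {f. locally_constant S f \<and> compact_support S f \<and> (\<forall>x. x \<notin> Xset S \<longrightarrow> f x = 0)}"

definition consistent :: "place set \<Rightarrow> (complex set \<Rightarrow> place \<Rightarrow> real) \<Rightarrow> bool" where
  "consistent S c \<longleftrightarrow>
     (\<forall>(K, v)\<in>Jset S. \<forall>L. number_field L \<and> K \<subseteq> L \<longrightarrow>
        c K v = (\<Sum>w\<in>{w \<in> places L. divides K w v}. c L w))"

definition Jstar :: "place set \<Rightarrow> (complex set \<Rightarrow> place \<Rightarrow> real) set" where
  "Jstar S = {c. consistent S c \<and> (\<forall>K v. (K, v) \<notin> Jset S \<longrightarrow> c K v = 0)}"

definition Lstar :: "place set \<Rightarrow> ((place \<Rightarrow> real) \<Rightarrow> real) set" where
  "Lstar S = {l. (\<forall>f\<in>LCc S. \<forall>g\<in>LCc S. l (\<lambda>x. f x + g x) = l f + l g)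
                \<and> (\<forall>a. \<forall>f\<in>LCc S. l (\<lambda>x. a * f x) = a * l f)
                \<and> (\<forall>f. f \<notin> LCc S \<longrightarrow> l f = 0)}"

definition adapted :: "place set \<Rightarrow> complex set \<Rightarrow> (place \<Rightarrow> real) \<Rightarrow> bool" where
  "adapted S K f \<longleftrightarrow> number_field K
     \<and> (\<forall>v\<in>MK S K. \<forall>y\<in>Yset K v. \<forall>y'\<in>Yset K v. f y = f y')
     \<and> finite {v \<in> MK S K. \<exists>y\<in>Yset K v. f y \<noteq> 0}"

definition fval :: "complex set \<Rightarrow> (place \<Rightarrow> real) \<Rightarrow> place \<Rightarrow> real" where
  "fval K f v = f (SOME y. y \<in> Yset K v)"

definition Phi :: "place set \<Rightarrow> (complex set \<Rightarrow> place \<Rightarrow> real) \<Rightarrow> (place \<Rightarrow> real) \<Rightarrow> real" where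
  "Phi S c f = (if f \<in> LCc S then
      (let K = (SOME K. adapted S K f) in
         \<Sum>v\<in>{v \<in> MK S K. \<exists>y\<in>Yset K v. f y \<noteq> 0}. c K v * fval K f v)
    else 0)"

end

theory Submission
  imports Defs
begin

text \<open>For \<^term>\<open>K\<close> and \<^term>\<open>v\<close> below a place of \<^term>\<open>S\<close>, the indicator of \<^term>\<open>Yset K v\<close> lies in
  \<^term>\<open>LCc S\<close>, and every function in \<^term>\<open>LCc S\<close> is a finite linear combination of such
  indicators for a single \<^term>\<open>K\<close>. Hence \<^term>\<open>c K v\<close> must be, and can be defined as, the
  value of the functional at this indicator; consistency expresses additivity over the partition
  of \<^term>\<open>Yset K v\<close> into the sets of the places above \<^term>\<open>v\<close> in a larger field.
  The substance is that this partition is finite and that \<^term>\<open>Yset K v\<close> is compact. Fix an absolute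
  value in \<^term>\<open>v\<close>. Each place above \<^term>\<open>v\<close> contains exactly one absolute value that extends it;
  by an approximation argument the extensions to a number field are finite in number, so the
  extensions to the algebraic closure form a closed subset of a product of finite sets, and
  Tychonoff's theorem applies.\<close>

section \<open>Number fields\<close>

text \<open>In HOL a sum over an infinite set is 0, so \<open>consistent\<close> says what is
  intended only because finitely many places lie above \<open>v\<close>; likewise a linear
  functional is additive over finite partitions only. Finiteness is proved over the rationals and
  inherited by every \<open>K\<close>, since an extension of \<phi> also extends the restriction of
  \<phi> to the rationals. There the coefficients of a linear relation have the same value under all
  extensions, so a term with the largest coefficient cannot be cancelled at the extension where its
  other factor is large. The restriction to the rationals is nontrivial because the places
  considered lie above places in \<open>S\<close>. The topology on places is given by generators, on
  equivalence classes; compactness is therefore proved for functions on \<open>Qbar\<close>,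
  extended by 0, and carried over by \<open>av_class\<close>. The functions are real valued, with
  the product of the usual topologies; only because the values and restrictions range over finite
  sets are "lies in this set of restrictions" and its negation both usable as topological
  conditions.\<close>

interpretation rat_vec: vector_space "\<lambda>(q::rat) (x::complex). of_rat q * x"
  by unfold_locales (auto simp: algebra_simps of_rat_add of_rat_mult)

lemma rat_span_eq_span: "finite B \<Longrightarrow> rat_span B = rat_vec.span B"
  by (auto simp: rat_span_def rat_vec.span_finite)

text \<open>Stated for indexed families because values may repeat, as for the powers of a root of
  unity; a repetition is itself a relation, with coefficients 1 and -1.\<close>

lemma rat_family_dependent:
  assumes "finite B" "finite I" "card B < card I" "\<And>i. i \<in> I \<Longrightarrow> f i \<in> rat_vec.span B"
  shows "\<exists>u. (\<exists>i\<in>I. u i \<noteq> 0) \<and> (\<Sum>i\<in>I. of_rat (u i) * f i) = 0"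
proof (cases "inj_on f I")
  case True
  have "rat_vec.dependent (f ` I)"
  proof (rule ccontr)
    assume "\<not> rat_vec.dependent (f ` I)"
    from rat_vec.independent_span_bound[OF assms(1) this] assms(4) have "card (f ` I) \<le> card B"
      by auto
    then show False using True assms(3) by (simp add: card_image)
  qed
  then obtain v where v: "\<exists>x\<in>f ` I. v x \<noteq> 0" "(\<Sum>x\<in>f ` I. of_rat (v x) * x) = 0"
    using rat_vec.dependent_finite[of "f ` I"] assms(2) by auto
  then show ?thesis using True by (intro exI[of _ "v \<circ> f"]) (auto simp: sum.reindex)
next
  case False
  then obtain i j where ij: "i \<in> I" "j \<in> I" "i \<noteq> j" "f i = f j" by (auto simp: inj_on_def)
  define u :: "'a \<Rightarrow> rat" where "u = (\<lambda>k. if k = i then 1 else if k = j then -1 else 0)"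
  have "(\<Sum>k\<in>I. of_rat (u k) * f k) = (\<Sum>k\<in>{i,j}. of_rat (u k) * f k)"
    using ij assms(2) by (intro sum.mono_neutral_right) (auto simp: u_def)
  also have "\<dots> = 0" using ij by (simp add: u_def)
  finally show ?thesis using ij(1) by (intro exI[of _ u]) (auto simp: u_def)
qed

lemma
  assumes "subfield F"
  shows subfield_0: "0 \<in> F" and subfield_1: "1 \<in> F"
    and subfield_add: "x \<in> F \<Longrightarrow> y \<in> F \<Longrightarrow> x + y \<in> F"
    and subfield_diff: "x \<in> F \<Longrightarrow> y \<in> F \<Longrightarrow> x - y \<in> F"
    and subfield_mult: "x \<in> F \<Longrightarrow> y \<in> F \<Longrightarrow> x * y \<in> F"
    and subfield_inverse: "x \<in> F \<Longrightarrow> inverse x \<in> F"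
  using assms by (auto simp: subfield_def)

lemma subfield_minus: "subfield F \<Longrightarrow> x \<in> F \<Longrightarrow> - x \<in> F"
  using subfield_diff[of F 0 x] subfield_0 by simp

lemma subfield_divide: "subfield F \<Longrightarrow> x \<in> F \<Longrightarrow> y \<in> F \<Longrightarrow> x / y \<in> F"
  by (simp add: divide_inverse subfield_inverse subfield_mult)

lemma subfield_power: "subfield F \<Longrightarrow> x \<in> F \<Longrightarrow> x ^ n \<in> F"
  by (induction n) (auto simp: subfield_1 subfield_mult)

lemma subfield_sum: "subfield F \<Longrightarrow> (\<And>i. i \<in> I \<Longrightarrow> f i \<in> F) \<Longrightarrow> sum f I \<in> F"
  by (induction I rule: infinite_finite_induct) (auto simp: subfield_0 subfield_add)

lemma subfield_of_nat: "subfield F \<Longrightarrow> of_nat n \<in> F"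
  by (induction n) (auto simp: subfield_0 subfield_1 subfield_add)

lemma subfield_of_int: "subfield F \<Longrightarrow> of_int n \<in> F"
  by (cases n) (auto simp: subfield_of_nat subfield_minus simp del: of_nat_Suc)

lemma Rats_subset_subfield: "subfield F \<Longrightarrow> \<rat> \<subseteq> F"
  by (auto elim!: Rats_cases' intro!: subfield_divide subfield_of_int)

lemma subfield_of_rat: "subfield F \<Longrightarrow> of_rat q \<in> F"
  by (rule subsetD[OF Rats_subset_subfield Rats_of_rat])

lemma subfield_Rats: "subfield \<rat>"
  by (auto simp: subfield_def)

text \<open>A ring of finite dimension over the rationals inside the complex numbers is a field:
  \<open>card B + 1\<close> powers of \<open>x\<close> satisfy a nontrivial rational relation, which
  makes \<open>x\<close> algebraic and also yields its inverse.\<close>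

lemma number_field_span:
  assumes B: "finite B" and one: "1 \<in> rat_vec.span B"
    and mult: "\<And>x y. x \<in> B \<Longrightarrow> y \<in> B \<Longrightarrow> x * y \<in> rat_vec.span B"
  shows "number_field (rat_vec.span B)"
proof -
  let ?R = "rat_vec.span B"
  have 1: "x * y \<in> ?R" if "x \<in> B" "y \<in> ?R" for x y
    using that(2)
  proof (induction rule: rat_vec.span_induct_alt)
    case base then show ?case by (simp add: rat_vec.span_zero)
  next
    case (step q b y)
    have "x * (of_rat q * b + y) = of_rat q * (x * b) + x * y" by (simp add: algebra_simps)
    then show ?case using step mult[OF that(1)] rat_vec.span_add rat_vec.span_scale by presburger
  qed
  have mult': "x * y \<in> ?R" if "x \<in> ?R" "y \<in> ?R" for x y
    using that(1)
  proof (induction rule: rat_vec.span_induct_alt)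
    case base then show ?case by (simp add: rat_vec.span_zero)
  next
    case (step q b x)
    have "(of_rat q * b + x) * y = of_rat q * (b * y) + x * y" by (simp add: algebra_simps)
    then show ?case using step 1 that(2) rat_vec.span_add rat_vec.span_scale by presburger
  qed
  have pow: "x ^ n \<in> ?R" if "x \<in> ?R" for x n
    by (induction n) (auto simp: one mult' that)
  have dep: "\<exists>u n. (\<exists>i\<le>n. u i \<noteq> 0) \<and> (\<Sum>i\<le>n. of_rat (u i) * x ^ i) = 0" if "x \<in> ?R" for x
    using rat_family_dependent[OF B, of "{..card B}" "\<lambda>i. x ^ i"] pow[OF that]
    by auto
  have "algebraic x" if x: "x \<in> ?R" for x
  proof -
    obtain u n where u: "\<exists>i\<le>n. u i \<noteq> 0" "(\<Sum>i\<le>n. of_rat (u i) * x ^ i) = 0"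
      using dep[OF x] by auto
    define p :: "complex poly" where "p = (\<Sum>i\<le>n. monom (of_rat (u i)) i)"
    have c: "coeff p i = (if i \<le> n then of_rat (u i) else 0)" for i
      by (simp add: p_def coeff_sum)
    have "poly p x = 0" using u(2) by (simp add: p_def poly_sum poly_monom)
    moreover have "p \<noteq> 0" using u(1) c by (metis coeff_0 of_rat_eq_0_iff)
    ultimately show ?thesis unfolding algebraic_altdef
      by (intro exI[of _ p]) (auto simp: c)
  qed
  moreover have "inverse x \<in> ?R" if x: "x \<in> ?R" "x \<noteq> 0" for x
  proof -
    obtain u n where u: "\<exists>i\<le>n. u i \<noteq> 0" "(\<Sum>i\<le>n. of_rat (u i) * x ^ i) = 0"
      using dep[OF x(1)] by auto
    \<comment> \<open>Cancelling the lowest power with nonzero coefficient leaves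
      \<open>u k + x * s = 0\<close>, so \<open>s\<close> is the inverse of \<open>x\<close> up to a
      rational factor.\<close>
    define k where "k = (LEAST i. i \<le> n \<and> u i \<noteq> 0)"
    have k: "k \<le> n" "u k \<noteq> 0" using u(1) LeastI_ex[of "\<lambda>i. i \<le> n \<and> u i \<noteq> 0"]
      by (auto simp: k_def)
    have lt: "u i = 0" if "i < k" for i
      using not_less_Least[OF that[unfolded k_def]] that k by auto
    define s where "s = (\<Sum>i\<in>{k<..n}. of_rat (u i) * x ^ (i - Suc k))"
    have "0 = (\<Sum>i\<in>{k..n}. of_rat (u i) * x ^ i)"
      unfolding u(2)[symmetric] by (intro sum.mono_neutral_right) (auto simp: lt not_le)
    also have "\<dots> = of_rat (u k) * x ^ k + (\<Sum>i\<in>{k<..n}. of_rat (u i) * x ^ i)"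
      using k by (simp add: sum.head)
    also have "(\<Sum>i\<in>{k<..n}. of_rat (u i) * x ^ i) = x ^ Suc k * s"
      unfolding s_def sum_distrib_left
      by (intro sum.cong refl) (auto simp flip: power_add simp del: power_Suc simp: algebra_simps)
    also have "of_rat (u k) * x ^ k + x ^ Suc k * s = x ^ k * (of_rat (u k) + x * s)"
      by (simp add: algebra_simps)
    finally have "of_rat (u k) + x * s = 0" using x(2) by auto
    then have xs: "x * s = - of_rat (u k)" by (simp add: add_eq_0_iff)
    have "x * (of_rat (- inverse (u k)) * s) = of_rat (- inverse (u k)) * (x * s)" by simp
    also have "\<dots> = 1" unfolding xs using k(2) by (simp add: of_rat_minus of_rat_inverse)
    finally have "inverse x = of_rat (- inverse (u k)) * s" by (rule inverse_unique)
    moreover have "s \<in> ?R" unfolding s_def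
      by (intro rat_vec.span_sum rat_vec.span_scale pow x)
    ultimately show ?thesis using rat_vec.span_scale by metis
  qed
  ultimately have "subfield ?R" "?R \<subseteq> Qbar"
    by (auto simp: subfield_def Qbar_def one mult' rat_vec.span_zero rat_vec.span_add rat_vec.span_diff)
  moreover have "B \<subseteq> ?R" "?R \<subseteq> rat_span B"
    using rat_span_eq_span[OF B] rat_vec.span_superset by auto
  ultimately show ?thesis unfolding number_field_def using B by blast
qed

lemma number_field_subfield: "number_field K \<Longrightarrow> subfield K"
  and number_field_subset_Qbar: "number_field K \<Longrightarrow> K \<subseteq> Qbar"
  by (auto simp: number_field_def)

lemma subfield_span:
  assumes "subfield F" "B \<subseteq> F" shows "rat_vec.span B \<subseteq> F"
proof
  fix x assume "x \<in> rat_vec.span B"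
  then show "x \<in> F"
    by (induction rule: rat_vec.span_induct_alt)
      (use assms in \<open>auto simp: subfield_0 subfield_add subfield_mult subfield_of_rat\<close>)
qed

lemma number_field_spanE:
  assumes "number_field K"
  obtains B where "finite B" "K = rat_vec.span B"
proof -
  obtain B where B: "finite B" "B \<subseteq> K" "K \<subseteq> rat_span B"
    using assms by (auto simp: number_field_def)
  moreover have "rat_vec.span B \<subseteq> K"
    using B assms by (intro subfield_span number_field_subfield)
  ultimately show ?thesis using rat_span_eq_span[OF B(1)] that[of B] by simp
qed

lemma number_field_Rats: "number_field \<rat>"
proof -
  have "rat_vec.span {1} = \<rat>"
    by (simp add: rat_vec.span_singleton Rats_def)
  then show ?thesis using number_field_span[of "{1}"] by simp
qed

text \<open>The products of a spanning set of \<open>K\<close> with one of \<open>L\<close> span a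
  ring, because (b c)(b' c') = (b b')(c c') is again an element of \<open>K\<close> times an element
  of \<open>L\<close>.\<close>

lemma number_field_compositum:
  assumes "number_field K" "number_field L"
  shows "\<exists>M. number_field M \<and> K \<subseteq> M \<and> L \<subseteq> M"
proof -
  obtain B where B: "finite B" "K = rat_vec.span B" using assms(1) by (rule number_field_spanE)
  obtain C where C: "finite C" "L = rat_vec.span C" using assms(2) by (rule number_field_spanE)
  note K = number_field_subfield[OF assms(1)] and L = number_field_subfield[OF assms(2)]
  define D where "D = (\<lambda>(b, c). b * c) ` (B \<times> C)"
  have 1: "x * c \<in> rat_vec.span D" if "x \<in> K" "c \<in> C" for x c
    using that(1) unfolding B
  proof (induction rule: rat_vec.span_induct_alt)
    case base then show ?case by (simp add: rat_vec.span_zero)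
  next
    case (step q b x)
    have "(of_rat q * b + x) * c = of_rat q * (b * c) + x * c" by (simp add: algebra_simps)
    moreover have "b * c \<in> rat_vec.span D"
      using step that by (intro rat_vec.span_base) (auto simp: D_def)
    ultimately show ?case using step rat_vec.span_add rat_vec.span_scale by presburger
  qed
  have 2: "x * y \<in> rat_vec.span D" if "x \<in> K" "y \<in> L" for x y
    using that(2) unfolding C
  proof (induction rule: rat_vec.span_induct_alt)
    case base then show ?case by (simp add: rat_vec.span_zero)
  next
    case (step q c y)
    have "x * (of_rat q * c + y) = of_rat q * (x * c) + x * y" by (simp add: algebra_simps)
    then show ?case using step 1[OF that(1)] rat_vec.span_add rat_vec.span_scale by presburger
  qed
  have BK: "B \<subseteq> K" "C \<subseteq> L" using B C rat_vec.span_superset by auto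
  have "number_field (rat_vec.span D)"
  proof (rule number_field_span)
    show "finite D" using B C by (simp add: D_def)
    show "1 \<in> rat_vec.span D" using 2[of 1 1] K L by (simp add: subfield_1)
    fix x y assume "x \<in> D" "y \<in> D"
    then obtain b c b' c' where "x = b * c" "y = b' * c'" "b \<in> B" "b' \<in> B" "c \<in> C" "c' \<in> C"
      by (auto simp: D_def)
    then have "x * y = (b * b') * (c * c')" "b \<in> K" "b' \<in> K" "c \<in> L" "c' \<in> L"
      using BK by auto
    then show "x * y \<in> rat_vec.span D" using 2 K L by (simp add: subfield_mult)
  qed
  then show ?thesis
    using 2[of _ 1] 2[of 1] K L by (intro exI[of _ "rat_vec.span D"]) (auto simp: subfield_1)
qed

lemma number_field_finite_compositum:
  assumes "finite A" "\<And>K. K \<in> A \<Longrightarrow> number_field K"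
  shows "\<exists>M. number_field M \<and> (\<forall>K\<in>A. K \<subseteq> M)"
  using assms
proof (induction A)
  case empty then show ?case using number_field_Rats by auto
next
  case (insert K A)
  then obtain M where M: "number_field M" "\<forall>K\<in>A. K \<subseteq> M" by auto
  obtain N where "number_field N" "K \<subseteq> N" "M \<subseteq> N"
    using number_field_compositum M(1) insert.prems by (meson insertI1)
  then show ?case using M by (intro exI[of _ N]) auto
qed

text \<open>The minimality clause lets a single field serve for every field containing
  \<open>x\<close>; \<open>finite_extension_values\<close> depends on that.\<close>

lemma simple_number_field:
  assumes "x \<in> Qbar"
  shows "\<exists>K. number_field K \<and> x \<in> K \<and> (\<forall>F. subfield F \<longrightarrow> x \<in> F \<longrightarrow> K \<subseteq> F)"
proof -
  obtain p where p: "\<And>i. coeff p i \<in> \<rat>" "p \<noteq> 0" "poly p x = 0"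
    using assms unfolding Qbar_def algebraic_altdef by auto
  define n where "n = degree p"
  have "n > 0"
  proof (rule ccontr)
    assume "\<not> n > 0"
    then obtain c where "p = [:c:]" unfolding n_def using degree_eq_zeroE by blast
    then show False using p by auto
  qed
  define B where "B = (\<lambda>i. x ^ i) ` {..<n}"
  have sB: "x ^ i \<in> rat_vec.span B" if "i < n" for i
    using that by (intro rat_vec.span_base) (auto simp: B_def)
  have xn: "x ^ n \<in> rat_vec.span B"
  proof -
    have q: "\<exists>r. coeff p i = of_rat r" for i using p(1) by (auto elim: Rats_cases)
    then obtain r where r: "\<And>i. coeff p i = of_rat (r i)" by metis
    have "0 = (\<Sum>i\<le>n. of_rat (r i) * x ^ i)" using p(3) by (simp add: poly_altdef n_def r)
    also have "{..n} = insert n {..<n}" by auto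
    finally have "of_rat (r n) * x ^ n = - (\<Sum>i<n. of_rat (r i) * x ^ i)"
      by (simp add: add_eq_0_iff)
    moreover have "r n \<noteq> 0" using p(2) r[of n] by (auto simp: n_def)
    moreover have "x ^ n = of_rat (inverse (r n)) * (of_rat (r n) * x ^ n)" if "r n \<noteq> 0"
      using that by (simp add: of_rat_inverse)
    ultimately have "x ^ n = of_rat (- inverse (r n)) * (\<Sum>i<n. of_rat (r i) * x ^ i)"
      by (simp add: of_rat_minus)
    also have "\<dots> \<in> rat_vec.span B"
      by (intro rat_vec.span_scale rat_vec.span_sum sB) auto
    finally show ?thesis .
  qed
  have x_mult: "x * y \<in> rat_vec.span B" if "y \<in> rat_vec.span B" for y
    using that
  proof (induction rule: rat_vec.span_induct_alt)
    case base then show ?case by (simp add: rat_vec.span_zero)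
  next
    case (step q b y)
    then obtain i where i: "i < n" "b = x ^ i" by (auto simp: B_def)
    have "x * b \<in> rat_vec.span B"
      using sB[of "Suc i"] xn i by (cases "Suc i = n") auto
    moreover have "x * (of_rat q * b + y) = of_rat q * (x * b) + x * y" by (simp add: algebra_simps)
    ultimately show ?case using step rat_vec.span_add rat_vec.span_scale by presburger
  qed
  have pow: "x ^ k \<in> rat_vec.span B" for k
    by (induction k) (use sB[of 0] \<open>n > 0\<close> x_mult in auto)
  have "number_field (rat_vec.span B)"
    by (rule number_field_span)
      (use pow[of 0] in \<open>auto simp: B_def simp flip: power_add intro!: pow[unfolded B_def]\<close>)
  moreover have "rat_vec.span B \<subseteq> F" if "subfield F" "x \<in> F" for F
    by (intro subfield_span that) (auto simp: B_def subfield_power that)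
  ultimately show ?thesis using pow[of 1] by auto
qed

text \<open>The axioms of a field and of an absolute value involve at most two elements at a time,
  so on \<open>Qbar\<close> they can be checked inside a number field above
  \<open>K\<close>.\<close>

lemma Qbar_common_number_field:
  assumes "number_field K" "x \<in> Qbar" "y \<in> Qbar"
  shows "\<exists>L. number_field L \<and> K \<subseteq> L \<and> x \<in> L \<and> y \<in> L"
proof -
  obtain A B where A: "number_field A" "x \<in> A" and B: "number_field B" "y \<in> B"
    using simple_number_field assms by meson
  then obtain L where "number_field L" "\<forall>F\<in>{K, A, B}. F \<subseteq> L"
    using number_field_finite_compositum[of "{K, A, B}"] assms(1) by auto
  then show ?thesis using A B by (intro exI[of _ L]) auto
qed

lemma subfield_Qbar: "subfield Qbar"
  unfolding subfield_def
proof (intro conjI ballI impI)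
  note * = Qbar_common_number_field[OF number_field_Rats]
  show "0 \<in> Qbar" "1 \<in> Qbar"
    using number_field_subset_Qbar[OF number_field_Rats] by auto
  show "x + y \<in> Qbar" "x - y \<in> Qbar" "x * y \<in> Qbar" if "x \<in> Qbar" "y \<in> Qbar" for x y
    using *[OF that] number_field_subset_Qbar
    by (meson number_field_subfield subfield_add subfield_diff subfield_mult subsetD)+
  show "inverse x \<in> Qbar" if "x \<in> Qbar" for x
    using *[OF that that] number_field_subset_Qbar
    by (meson number_field_subfield subfield_inverse subsetD)
qed

section \<open>Absolute values and places\<close>

lemma
  assumes "abs_value F \<phi>"
  shows abs_value_nonneg: "\<phi> x \<ge> 0"
    and abs_value_eq_0: "x \<in> F \<Longrightarrow> \<phi> x = 0 \<longleftrightarrow> x = 0"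
    and abs_value_mult: "x \<in> F \<Longrightarrow> y \<in> F \<Longrightarrow> \<phi> (x * y) = \<phi> x * \<phi> y"
    and abs_value_add: "x \<in> F \<Longrightarrow> y \<in> F \<Longrightarrow> \<phi> (x + y) \<le> \<phi> x + \<phi> y"
    and abs_value_outside: "x \<notin> F \<Longrightarrow> \<phi> x = 0"
  using assms by (cases "x \<in> F"; simp add: abs_value_def)+

context
  fixes F \<phi>
  assumes F: "subfield F" and av: "abs_value F \<phi>"
begin

lemma abs_value_0: "\<phi> 0 = 0"
  using abs_value_eq_0[OF av, of 0] subfield_0[OF F] by simp

lemma abs_value_1: "\<phi> 1 = 1"
  using abs_value_mult[OF av, of 1 1] abs_value_eq_0[OF av, of 1] subfield_1[OF F] by simp

lemma abs_value_pos: "x \<in> F \<Longrightarrow> x \<noteq> 0 \<Longrightarrow> \<phi> x > 0"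
  using abs_value_nonneg[OF av, of x] abs_value_eq_0[OF av, of x] by simp

lemma abs_value_power: "x \<in> F \<Longrightarrow> \<phi> (x ^ n) = \<phi> x ^ n"
  by (induction n) (auto simp: abs_value_1 abs_value_mult[OF av] subfield_power[OF F])

lemma abs_value_minus:
  assumes "x \<in> F" shows "\<phi> (- x) = \<phi> x"
proof -
  have m1: "-1 \<in> F" using subfield_minus[OF F subfield_1[OF F]] .
  have "\<phi> (-1) ^ 2 = 1" using abs_value_power[OF m1, of 2] abs_value_1 by simp
  then have "\<phi> (-1) = 1" using abs_value_nonneg[OF av, of "-1"] by (simp add: power2_eq_1_iff)
  then show ?thesis using abs_value_mult[OF av m1 assms] by simp
qed

lemma abs_value_diff: "x \<in> F \<Longrightarrow> y \<in> F \<Longrightarrow> \<phi> x - \<phi> y \<le> \<phi> (x + y)"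
  using abs_value_add[OF av, of "x + y" "- y"] abs_value_minus[of y]
  by (simp add: subfield_add[OF F] subfield_minus[OF F])

lemma abs_value_inverse: "x \<in> F \<Longrightarrow> \<phi> (inverse x) = inverse (\<phi> x)"
  using abs_value_mult[OF av, of x "inverse x"] abs_value_1 abs_value_0 subfield_inverse[OF F, of x]
  by (cases "x = 0") (auto intro!: inverse_unique[symmetric])

lemma abs_value_divide: "x \<in> F \<Longrightarrow> y \<in> F \<Longrightarrow> \<phi> (x / y) = \<phi> x / \<phi> y"
  by (simp add: divide_inverse abs_value_mult[OF av] abs_value_inverse subfield_inverse[OF F])

lemma abs_value_sum:
  assumes "\<And>i. i \<in> I \<Longrightarrow> f i \<in> F"
  shows "\<phi> (sum f I) \<le> (\<Sum>i\<in>I. \<phi> (f i))"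
  using assms
proof (induction I rule: infinite_finite_induct)
  case (insert i I)
  then have "\<phi> (f i + sum f I) \<le> \<phi> (f i) + \<phi> (sum f I)"
    by (intro abs_value_add[OF av] subfield_sum[OF F]) auto
  with insert show ?case by fastforce
qed (auto simp: abs_value_0)

lemma abs_value_of_nat_le: "\<phi> (of_nat n) \<le> of_nat n"
proof (induction n)
  case (Suc n)
  then show ?case
    using abs_value_add[OF av, of 1 "of_nat n"] subfield_1[OF F] subfield_of_nat[OF F, of n]
    by (simp add: abs_value_1)
qed (simp add: abs_value_0)

end

section \<open>The triangle inequality for powers of an absolute value\<close>

lemma power_powr_commute: "0 \<le> (a::real) \<Longrightarrow> (a ^ n) powr s = (a powr s) ^ n"
  by (induction n) (auto simp: powr_mult)

text \<open>If \<open>B < A\<close>, then (n + 1) (B / A)^n would stay at least 1 although it tends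
  to 0. The factor n + 1 is the number of terms of a binomial expansion.\<close>

lemma le_if_power_le_linear_mult_power:
  fixes A B :: real
  assumes "A \<ge> 0" "B \<ge> 0" "\<And>n. A ^ n \<le> (real n + 1) * B ^ n"
  shows "A \<le> B"
proof (rule ccontr)
  assume "\<not> A \<le> B"
  define x where "x = B / A"
  have A: "A > 0" and x: "norm x < 1" using \<open>\<not> A \<le> B\<close> assms(2) by (auto simp: x_def)
  have "(\<lambda>n. real n * x ^ n + x ^ n) \<longlonglongrightarrow> 0 + 0"
    by (intro tendsto_add powser_times_n_limit_0 LIMSEQ_power_zero x)
  moreover have "real n * x ^ n + x ^ n \<ge> 1" for n
    using assms(3)[of n] A by (simp add: x_def power_divide field_simps)
  ultimately show False using LIMSEQ_le_const[of _ 0 1] by force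
qed

text \<open>An equivalent power of an absolute value may violate the triangle inequality. If it is
  bounded by the identity on the natural numbers, expanding $(x + y)^n$ and taking $n$-th roots
  restores it.\<close>

lemma abs_value_powr:
  assumes F: "subfield F" and av: "abs_value F \<phi>" and t: "t > 0"
    and nat: "\<And>n. \<phi> (of_nat n) powr t \<le> of_nat n"
  shows "abs_value F (\<lambda>x. \<phi> x powr t)"
proof -
  have "\<phi> (x + y) powr t \<le> \<phi> x powr t + \<phi> y powr t" if xy: "x \<in> F" "y \<in> F" for x y
  proof -
    define a b where "a = \<phi> x powr t" and "b = \<phi> y powr t"
    have ab: "a \<ge> 0" "b \<ge> 0" by (auto simp: a_def b_def)
    have root: "\<phi> z = (\<phi> z powr t) powr (1 / t)" for z
      using t abs_value_nonneg[OF av] by (simp add: powr_powr)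
    have "\<phi> (x + y) \<le> (a + b) powr (1 / t)"
    proof (rule le_if_power_le_linear_mult_power)
      fix n
      \<comment> \<open>Only \<phi> itself is known to be subadditive, so the estimate is made for
        \<phi>. Each binomial term is bounded by the whole sum (a + b)^n, the assumption
        \<open>nat\<close> taking care of the coefficient; the n + 1 terms then cost only the factor
        that disappears on taking roots.\<close>
      have le: "\<phi> (of_nat (n choose k) * x ^ k * y ^ (n - k)) \<le> ((a + b) ^ n) powr (1 / t)"
        if "k \<le> n" for k
      proof -
        have "\<phi> (of_nat (n choose k) * x ^ k * y ^ (n - k)) powr t
            = \<phi> (of_nat (n choose k)) powr t * a ^ k * b ^ (n - k)"
          using xy by (simp add: abs_value_mult[OF av] abs_value_power[OF F av] subfield_mult[OF F]
              subfield_power[OF F] subfield_of_nat[OF F] powr_mult abs_value_nonneg[OF av]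
              power_powr_commute a_def b_def)
        also have "\<dots> \<le> of_nat (n choose k) * a ^ k * b ^ (n - k)"
          using ab by (intro mult_right_mono nat) auto
        also have "\<dots> \<le> (\<Sum>k\<le>n. of_nat (n choose k) * a ^ k * b ^ (n - k))"
          using ab that by (intro member_le_sum) auto
        also have "\<dots> = (a + b) ^ n" by (simp add: binomial_ring)
        finally have "(\<phi> (of_nat (n choose k) * x ^ k * y ^ (n - k)) powr t) powr (1 / t)
            \<le> ((a + b) ^ n) powr (1 / t)"
          using t by (intro powr_mono2) auto
        then show ?thesis by (simp flip: root)
      qed
      have "\<phi> (x + y) ^ n = \<phi> (\<Sum>k\<le>n. of_nat (n choose k) * x ^ k * y ^ (n - k))"
        using xy by (simp flip: abs_value_power[OF F av] binomial_ring add: subfield_add[OF F])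
      also have "\<dots> \<le> (\<Sum>k\<le>n. \<phi> (of_nat (n choose k) * x ^ k * y ^ (n - k)))"
        using xy by (intro abs_value_sum[OF F av] subfield_mult[OF F] subfield_power[OF F]
            subfield_of_nat[OF F])
      also have "\<dots> \<le> (\<Sum>k\<le>n. ((a + b) ^ n) powr (1 / t))"
        by (intro sum_mono le) auto
      also have "\<dots> = (real n + 1) * ((a + b) powr (1 / t)) ^ n"
        using ab by (simp add: power_powr_commute)
      finally show "\<phi> (x + y) ^ n \<le> (real n + 1) * ((a + b) powr (1 / t)) ^ n" .
    qed (auto simp: abs_value_nonneg[OF av])
    then have "\<phi> (x + y) powr t \<le> ((a + b) powr (1 / t)) powr t"
      using t by (intro powr_mono2 abs_value_nonneg[OF av]) auto
    also have "\<dots> = a + b" using t ab by (simp add: powr_powr)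
    finally show ?thesis by (simp add: a_def b_def)
  qed
  then show ?thesis using av t by (auto simp: abs_value_def powr_mult)
qed

section \<open>Places as classes of absolute values, and places in towers of fields\<close>

definition av_class :: "complex set \<Rightarrow> absval \<Rightarrow> place" where
  "av_class F \<phi> = {\<psi>. abs_value F \<psi> \<and> equiv_av F \<phi> \<psi>}"

definition extensions :: "complex set \<Rightarrow> absval \<Rightarrow> complex set \<Rightarrow> absval set" where
  "extensions K \<phi> F = {\<psi>. abs_value F \<psi> \<and> restr K \<psi> = \<phi>}"

lemma
  assumes "\<psi> \<in> extensions K \<phi> F"
  shows extension_abs_value: "abs_value F \<psi>"
    and extension_eq: "x \<in> K \<Longrightarrow> \<psi> x = \<phi> x"
  using assms by (auto simp: extensions_def restr_def)

lemma places_eq: "places F = av_class F ` {\<phi>. abs_value F \<phi> \<and> nontrivial_av F \<phi>}"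
  by (auto simp: places_def av_class_def)

lemma equiv_av_refl: "abs_value F \<phi> \<Longrightarrow> equiv_av F \<phi> \<phi>"
  unfolding equiv_av_def by (intro exI[of _ 1]) (auto simp: abs_value_def)

lemma equiv_av_sym:
  assumes "abs_value F \<phi>" "equiv_av F \<phi> \<psi>" shows "equiv_av F \<psi> \<phi>"
proof -
  obtain t where "t > 0" "\<forall>x\<in>F. \<psi> x = \<phi> x powr t" using assms(2) by (auto simp: equiv_av_def)
  then show ?thesis unfolding equiv_av_def
    using abs_value_nonneg[OF assms(1)] by (intro exI[of _ "1 / t"]) (auto simp: powr_powr)
qed

lemma equiv_av_trans:
  assumes "equiv_av F \<phi> \<psi>" "equiv_av F \<psi> \<rho>" shows "equiv_av F \<phi> \<rho>"
proof -
  obtain t where t: "t > 0" "\<forall>x\<in>F. \<psi> x = \<phi> x powr t" using assms(1) by (auto simp: equiv_av_def)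
  obtain s where "s > 0" "\<forall>x\<in>F. \<rho> x = \<psi> x powr s" using assms(2) by (auto simp: equiv_av_def)
  with t show ?thesis unfolding equiv_av_def
    by (intro exI[of _ "t * s"]) (auto simp: powr_powr)
qed

lemma av_class_self: "abs_value F \<phi> \<Longrightarrow> \<phi> \<in> av_class F \<phi>"
  by (simp add: av_class_def equiv_av_refl)

lemma av_class_cong:
  "abs_value F \<phi> \<Longrightarrow> equiv_av F \<phi> \<psi> \<Longrightarrow> av_class F \<phi> = av_class F \<psi>"
  unfolding av_class_def using equiv_av_sym equiv_av_trans by (intro Collect_cong) metis

lemma nontrivial_av_equiv:
  assumes "abs_value F \<phi>" "nontrivial_av F \<phi>" "equiv_av F \<phi> \<psi>"
  shows "nontrivial_av F \<psi>"
proof -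
  obtain t where t: "t > 0" "\<forall>x\<in>F. \<psi> x = \<phi> x powr t" using assms(3) by (auto simp: equiv_av_def)
  obtain x where x: "x \<in> F" "x \<noteq> 0" "\<phi> x \<noteq> 1" using assms(2) by (auto simp: nontrivial_av_def)
  then have "\<phi> x powr t \<noteq> 1"
    using t abs_value_nonneg[OF assms(1), of x] abs_value_eq_0[OF assms(1), of x]
    by (auto simp: powr_eq_one_iff_gen)
  with t x show ?thesis by (auto simp: nontrivial_av_def)
qed

lemma
  assumes "w \<in> places F" "\<phi> \<in> w"
  shows place_abs_value: "abs_value F \<phi>"
    and place_nontrivial: "nontrivial_av F \<phi>"
    and place_eq_av_class: "w = av_class F \<phi>"
proof -
  obtain \<psi> where \<psi>: "abs_value F \<psi>" "nontrivial_av F \<psi>" "w = av_class F \<psi>"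
    using assms(1) by (auto simp: places_eq)
  with assms(2) have \<phi>: "abs_value F \<phi>" "equiv_av F \<psi> \<phi>" by (auto simp: av_class_def)
  show "abs_value F \<phi>" by fact
  show "nontrivial_av F \<phi>" using \<psi> \<phi> nontrivial_av_equiv by blast
  show "w = av_class F \<phi>" using \<psi> \<phi> av_class_cong by simp
qed

lemma place_nonempty:
  assumes "w \<in> places F" obtains \<phi> where "\<phi> \<in> w"
  using assms av_class_self by (auto simp: places_eq)

lemma abs_value_restr: "subfield K \<Longrightarrow> K \<subseteq> F \<Longrightarrow> abs_value F \<phi> \<Longrightarrow> abs_value K (restr K \<phi>)"
  unfolding abs_value_def restr_def
  by (auto simp: subfield_add subfield_mult subset_iff)

lemma restr_restr: "K \<subseteq> L \<Longrightarrow> restr K (restr L \<phi>) = restr K \<phi>"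
  by (auto simp: restr_def fun_eq_iff)

lemma nontrivial_av_restr: "K \<subseteq> F \<Longrightarrow> nontrivial_av K (restr K \<phi>) \<Longrightarrow> nontrivial_av F \<phi>"
  by (auto simp: nontrivial_av_def restr_def split: if_splits)

lemma equiv_av_restr: "K \<subseteq> F \<Longrightarrow> equiv_av F \<phi> \<psi> \<Longrightarrow> equiv_av K (restr K \<phi>) (restr K \<psi>)"
  by (auto simp: equiv_av_def restr_def)

text \<open>\<open>divides\<close> asks only for some representative, but equivalent absolute values
  have equivalent restrictions, so any representative decides.\<close>

lemma divides_iff:
  assumes "subfield K" "K \<subseteq> F" "w \<in> places F" "v \<in> places K" "\<phi> \<in> w"
  shows "divides K w v \<longleftrightarrow> restr K \<phi> \<in> v"
proof
  assume "divides K w v"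
  then obtain \<psi> where \<psi>: "\<psi> \<in> w" "restr K \<psi> \<in> v" by (auto simp: divides_def)
  note \<phi>av = place_abs_value[OF assms(3,5)]
  have "equiv_av F \<psi> \<phi>"
    using place_eq_av_class[OF assms(3) \<psi>(1)] assms(5) by (simp add: av_class_def)
  then have "equiv_av K (restr K \<psi>) (restr K \<phi>)" by (rule equiv_av_restr[OF assms(2)])
  then show "restr K \<phi> \<in> v"
    using place_eq_av_class[OF assms(4) \<psi>(2)] abs_value_restr[OF assms(1,2) \<phi>av]
    by (simp add: av_class_def)
qed (use assms in \<open>auto simp: divides_def\<close>)

lemma divides_unique:
  assumes "subfield K" "K \<subseteq> F" "w \<in> places F" "v \<in> places K" "v' \<in> places K"
    and "divides K w v" "divides K w v'"
  shows "v = v'"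
proof -
  obtain \<phi> where \<phi>: "\<phi> \<in> w" using assms(3) by (rule place_nonempty)
  then have "restr K \<phi> \<in> v" "restr K \<phi> \<in> v'" using divides_iff assms by blast+
  then show ?thesis using place_eq_av_class assms(4,5) by metis
qed

lemma divides_trans_iff:
  assumes "subfield K" "subfield L" "K \<subseteq> L" "L \<subseteq> F"
    and "y \<in> places F" "w \<in> places L" "v \<in> places K" "divides L y w"
  shows "divides K y v \<longleftrightarrow> divides K w v"
proof -
  obtain \<phi> where \<phi>: "\<phi> \<in> y" using assms(5) by (rule place_nonempty)
  then have "restr L \<phi> \<in> w" using divides_iff[of L F] assms by blast
  then show ?thesis
    using divides_iff[of K F y v \<phi>] divides_iff[of K L w v "restr L \<phi>"] assms \<phi> restr_restr[of K L]
    by simp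
qed

text \<open>The place is the class of the restriction to \<open>L\<close>, which is nontrivial
  because its further restriction to \<open>K\<close> already is.\<close>

lemma intermediate_place:
  assumes "subfield K" "subfield L" "K \<subseteq> L" "L \<subseteq> F"
    and "y \<in> places F" "v \<in> places K" "divides K y v"
  shows "\<exists>w\<in>places L. divides L y w \<and> divides K w v"
proof -
  obtain \<phi> where \<phi>: "\<phi> \<in> y" using assms(5) by (rule place_nonempty)
  then have "restr K \<phi> \<in> v" using divides_iff[of K F y v \<phi>] assms by auto
  then have "nontrivial_av K (restr K (restr L \<phi>))"
    using place_nontrivial assms(3,6) restr_restr by simp
  then have "nontrivial_av L (restr L \<phi>)" using assms(3) nontrivial_av_restr by blast
  moreover have av: "abs_value L (restr L \<phi>)"
    using abs_value_restr place_abs_value[OF assms(5) \<phi>] assms by blast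
  ultimately have w: "av_class L (restr L \<phi>) \<in> places L" by (auto simp: places_eq)
  moreover have "divides L y (av_class L (restr L \<phi>))"
    using \<phi> av_class_self[OF av] by (auto simp: divides_def)
  ultimately show ?thesis using divides_trans_iff[OF assms(1-5) w assms(6)] assms(7) by blast
qed

text \<open>Normalising by the value on \<^term>\<open>K\<close> turns places above \<^term>\<open>v\<close> into functions.\<close>

lemma bij_betw_extensions_places_above:
  assumes K: "subfield K" and F: "subfield F" and KF: "K \<subseteq> F" and v: "v \<in> places K" "\<phi> \<in> v"
  shows "bij_betw (av_class F) (extensions K \<phi> F) {w \<in> places F. divides K w v}"
  unfolding bij_betw_def
proof
  have \<phi>: "abs_value K \<phi>" "nontrivial_av K \<phi>" using v place_abs_value place_nontrivial by auto
  obtain a where a: "a \<in> K" "a \<noteq> 0" "\<phi> a \<noteq> 1" using \<phi>(2) by (auto simp: nontrivial_av_def)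
  have pos: "\<phi> a > 0" using abs_value_pos[OF K \<phi>(1)] a by simp
  show "inj_on (av_class F) (extensions K \<phi> F)"
  proof (rule inj_onI)
    fix \<psi> \<rho> assume *: "\<psi> \<in> extensions K \<phi> F" "\<rho> \<in> extensions K \<phi> F" "av_class F \<psi> = av_class F \<rho>"
    then have av: "abs_value F \<psi>" "abs_value F \<rho>" "\<psi> a = \<phi> a" "\<rho> a = \<phi> a"
      using a extension_abs_value extension_eq by blast+
    then have "\<rho> \<in> av_class F \<psi>" using * av_class_self by simp
    then obtain t where t: "t > 0" "\<forall>x\<in>F. \<rho> x = \<psi> x powr t"
      by (auto simp: av_class_def equiv_av_def)
    \<comment> \<open>A positive value other than 1 determines the exponent.\<close>
    then have "\<phi> a powr t = \<phi> a powr 1" using av a KF pos by auto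
    then have "t = 1" using pos a powr_inj[of "\<phi> a" t 1] by simp
    then have "\<rho> x = \<psi> x" for x
      using t av abs_value_nonneg[OF av(1), of x] abs_value_outside[OF av(1), of x]
        abs_value_outside[OF av(2), of x]
      by (cases "x \<in> F") auto
    then show "\<psi> = \<rho>" by auto
  qed
  show "av_class F ` extensions K \<phi> F = {w \<in> places F. divides K w v}"
  proof (intro equalityI subsetI)
    fix w assume "w \<in> av_class F ` extensions K \<phi> F"
    then obtain \<psi> where \<psi>: "abs_value F \<psi>" "restr K \<psi> = \<phi>" "w = av_class F \<psi>"
      by (auto simp: extensions_def)
    then show "w \<in> {w \<in> places F. divides K w v}"
      using \<phi> nontrivial_av_restr[OF KF, of \<psi>] av_class_self[of F \<psi>] v
      by (auto simp: places_eq divides_def)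
  next
    fix w assume "w \<in> {w \<in> places F. divides K w v}"
    then have w: "w \<in> places F" "divides K w v" by auto
    then obtain \<psi> where \<psi>: "\<psi> \<in> w" "restr K \<psi> \<in> v" by (auto simp: divides_def)
    have \<psi>av: "abs_value F \<psi>" using w \<psi> place_abs_value by blast
    have "v = av_class K (restr K \<psi>)" using v \<psi> place_eq_av_class by blast
    then obtain t where t: "t > 0" "\<And>x. x \<in> K \<Longrightarrow> \<phi> x = \<psi> x powr t"
      using v by (auto simp: av_class_def equiv_av_def restr_def)
    define \<rho> where "\<rho> = (\<lambda>x. \<psi> x powr t)"
    \<comment> \<open>On natural numbers this power is \<phi>, an honest absolute value, and hence
      is bounded by \<open>n\<close>; that is the condition of
      \<open>abs_value_powr\<close>.\<close>
    have "\<psi> (of_nat n) powr t \<le> of_nat n" for n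
      using abs_value_of_nat_le[OF K \<phi>(1), of n] t(2)[OF subfield_of_nat[OF K]] by simp
    then have \<rho>: "abs_value F \<rho>" unfolding \<rho>_def by (intro abs_value_powr F \<psi>av t)
    moreover have "restr K \<rho> = \<phi>"
      using t(2) abs_value_outside[OF \<phi>(1)] by (auto simp: restr_def \<rho>_def fun_eq_iff)
    moreover have "equiv_av F \<psi> \<rho>" using t(1) by (auto simp: equiv_av_def \<rho>_def)
    then have "w = av_class F \<rho>"
      using place_eq_av_class[OF w(1) \<psi>(1)] av_class_cong[OF \<psi>av] by simp
    ultimately show "w \<in> av_class F ` extensions K \<phi> F" by (auto simp: extensions_def)
  qed
qed

section \<open>Finiteness of extensions\<close>

lemma abs_value_power_int:
  "subfield F \<Longrightarrow> abs_value F \<phi> \<Longrightarrow> x \<in> F \<Longrightarrow> \<phi> (x powi k) = \<phi> x powi k"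
  by (simp add: power_int_def abs_value_power abs_value_inverse subfield_inverse)

lemma subfield_power_int: "subfield F \<Longrightarrow> x \<in> F \<Longrightarrow> x powi k \<in> F"
  by (simp add: power_int_def subfield_power subfield_inverse)

lemma nontrivial_abs_value_gt_1:
  assumes "subfield K" "abs_value K \<phi>" "nontrivial_av K \<phi>"
  shows "\<exists>a\<in>K. \<phi> a > 1"
proof -
  obtain a where a: "a \<in> K" "a \<noteq> 0" "\<phi> a \<noteq> 1" using assms(3) by (auto simp: nontrivial_av_def)
  then have "\<phi> a > 0" using abs_value_pos assms by blast
  then have "\<phi> a > 1 \<or> \<phi> (inverse a) > 1"
    using a abs_value_inverse[OF assms(1,2) a(1)] by (auto simp: one_less_inverse_iff)
  then show ?thesis using a subfield_inverse[OF assms(1)] by blast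
qed

text \<open>The values of the integer powers of \<open>a\<close> form a geometric progression with
  ratio \<open>\<phi> a\<close>, so one of them falls into each interval from \<open>y\<close>
  (excluded) to \<open>\<phi> a * y\<close> (included).\<close>

lemma dense_up_to_factor:
  assumes "subfield K" "abs_value K \<phi>" "a \<in> K" "\<phi> a > 1" "y > 0"
  shows "\<exists>c\<in>K. c \<noteq> 0 \<and> y < \<phi> c \<and> \<phi> c \<le> \<phi> a * y"
proof -
  define A where "A = \<phi> a"
  define k where "k = \<lfloor>log A y\<rfloor> + 1"
  have A: "A > 1" using assms by (simp add: A_def)
  have "\<phi> (a powi k) = A powr k"
    using A abs_value_power_int[OF assms(1-3)] by (simp add: A_def powr_real_of_int')
  moreover have "A powr log A y < A powr k" unfolding k_def using A by (intro powr_less_mono) linarith+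
  moreover have "A powr k \<le> A powr (1 + log A y)" unfolding k_def using A by (intro powr_mono) linarith+
  ultimately have "y < \<phi> (a powi k)" "\<phi> (a powi k) \<le> A * y"
    using A assms(5) by (simp_all add: powr_add)
  moreover have "a powi k \<noteq> 0"
  proof
    assume "a powi k = 0"
    with \<open>y < \<phi> (a powi k)\<close> assms(5) abs_value_0[OF assms(1,2)] show False by simp
  qed
  ultimately show ?thesis
    using subfield_power_int[OF assms(1,3), of k] unfolding A_def by blast
qed

text \<open>Both extensions agree on \<open>K\<close>, which gives a common scale. Powers of an
  element \<open>y\<close> with different values widen the ratio of the two values beyond
  \<open>\<phi> a\<close>; then the value of some \<open>c\<close> in \<open>K\<close> fits between
  them, and dividing by \<open>c\<close> puts 1 in between.\<close>

lemma distinct_extensions_separated: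
  assumes K: "subfield K" and F: "subfield F" and KF: "K \<subseteq> F"
    and \<phi>: "abs_value K \<phi>" "nontrivial_av K \<phi>"
    and ext: "\<psi> \<in> extensions K \<phi> F" "\<rho> \<in> extensions K \<phi> F" and ne: "\<psi> \<noteq> \<rho>"
  shows "\<exists>z\<in>F. \<psi> z > 1 \<and> \<rho> z < 1"
proof -
  note \<psi> = extension_abs_value[OF ext(1)] and \<rho> = extension_abs_value[OF ext(2)]
  obtain x where x: "\<psi> x \<noteq> \<rho> x" using ne by auto
  have xF: "x \<in> F" using x abs_value_outside[OF \<psi>] abs_value_outside[OF \<rho>] by metis
  have x0: "x \<noteq> 0" using x abs_value_0[OF F] \<psi> \<rho> by metis
  have "\<exists>y\<in>F. y \<noteq> 0 \<and> \<psi> y > \<rho> y"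
  proof (cases "\<psi> x > \<rho> x")
    case True then show ?thesis using xF x0 by blast
  next
    case False
    then have "\<psi> (inverse x) > \<rho> (inverse x)"
      using x abs_value_inverse[OF F \<psi> xF] abs_value_inverse[OF F \<rho> xF]
        abs_value_pos[OF F \<psi> xF x0] by (simp add: less_imp_inverse_less)
    then show ?thesis using xF x0 subfield_inverse[OF F] by (intro bexI[of _ "inverse x"]) auto
  qed
  then obtain y where y: "y \<in> F" "y \<noteq> 0" "\<psi> y > \<rho> y" by blast
  obtain a where a: "a \<in> K" "\<phi> a > 1" using nontrivial_abs_value_gt_1[OF K \<phi>] by blast
  have pos: "\<rho> y > 0" using abs_value_pos[OF F \<rho>] y by simp
  then have "\<psi> y / \<rho> y > 1" using y by simp
  then obtain n where "(\<psi> y / \<rho> y) ^ n > \<phi> a" using real_arch_pow by blast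
  then have n: "\<phi> a * \<rho> y ^ n < \<psi> y ^ n" using pos by (simp add: power_divide field_simps)
  obtain c where c: "c \<in> K" "c \<noteq> 0" "\<rho> y ^ n < \<phi> c" "\<phi> c \<le> \<phi> a * \<rho> y ^ n"
    using dense_up_to_factor[OF K \<phi>(1) a, of "\<rho> y ^ n"] pos by auto
  have cF: "c \<in> F" and c': "\<psi> c = \<phi> c" "\<rho> c = \<phi> c" and cpos: "\<phi> c > 0"
    using c(1,2) KF extension_eq[OF ext(1)] extension_eq[OF ext(2)] abs_value_pos[OF K \<phi>(1)] by auto
  have "\<psi> (y ^ n / c) > 1" "\<rho> (y ^ n / c) < 1"
    using n c(3,4) cpos y(1) cF
    by (simp_all add: abs_value_divide[OF F] \<psi> \<rho> abs_value_power[OF F] subfield_power[OF F] c')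
  then show ?thesis using subfield_divide[OF F subfield_power[OF F y(1)] cF] by blast
qed

text \<open>The quotient behaves in the limit like an indicator of the absolute values that are
  large at \<open>z\<close>. For large \<open>\<phi> z\<close>, dividing numerator and denominator
  by \<open>z ^ r\<close> leaves only powers of \<open>inverse z\<close>, which tend to 0.\<close>

lemma
  assumes F: "subfield F" and av: "abs_value F \<phi>" and z: "z \<in> F"
  shows tendsto_abs_value_quotient_0: "\<phi> z < 1 \<Longrightarrow> (\<lambda>r. \<phi> (z ^ r / (1 + z ^ r))) \<longlonglongrightarrow> 0"
    and tendsto_abs_value_quotient_1: "\<phi> z > 1 \<Longrightarrow> (\<lambda>r. \<phi> (z ^ r / (1 + z ^ r))) \<longlonglongrightarrow> 1"
proof -
  have lim: "(\<lambda>r. \<phi> (1 + x ^ r)) \<longlonglongrightarrow> 1" if x: "x \<in> F" "\<phi> x < 1" for x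
  proof (rule tendsto_sandwich)
    have *: "(\<lambda>r. \<phi> x ^ r) \<longlonglongrightarrow> 0"
      using x abs_value_nonneg[OF av, of x] by (intro LIMSEQ_power_zero) auto
    show "(\<lambda>r. 1 - \<phi> x ^ r) \<longlonglongrightarrow> 1" "(\<lambda>r. 1 + \<phi> x ^ r) \<longlonglongrightarrow> 1"
      using tendsto_diff[OF tendsto_const *, of 1] tendsto_add[OF tendsto_const *, of 1] by simp_all
    show "\<forall>\<^sub>F r in sequentially. 1 - \<phi> x ^ r \<le> \<phi> (1 + x ^ r)"
      "\<forall>\<^sub>F r in sequentially. \<phi> (1 + x ^ r) \<le> 1 + \<phi> x ^ r"
      using abs_value_diff[OF F av subfield_1[OF F] subfield_power[OF F x(1)]]
        abs_value_add[OF av subfield_1[OF F] subfield_power[OF F x(1)]]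
      by (simp_all add: abs_value_power[OF F av x(1)] abs_value_1[OF F av])
  qed
  note mem = subfield_add[OF F subfield_1[OF F] subfield_power[OF F]]
  show "(\<lambda>r. \<phi> (z ^ r / (1 + z ^ r))) \<longlonglongrightarrow> 0" if "\<phi> z < 1"
  proof -
    have "(\<lambda>r. \<phi> z ^ r) \<longlonglongrightarrow> 0"
      using that abs_value_nonneg[OF av, of z] by (intro LIMSEQ_power_zero) auto
    from tendsto_divide[OF this lim[OF z that]] show ?thesis
      using z by (simp add: abs_value_divide[OF F av] mem subfield_power[OF F] abs_value_power[OF F av])
  qed
  show "(\<lambda>r. \<phi> (z ^ r / (1 + z ^ r))) \<longlonglongrightarrow> 1" if "\<phi> z > 1"
  proof -
    have z0: "z \<noteq> 0" using that abs_value_0[OF F av] by auto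
    have zi: "inverse z \<in> F" using z subfield_inverse[OF F] by blast
    have "\<phi> (inverse z) < 1" using that abs_value_inverse[OF F av z] by (simp add: inverse_less_1_iff)
    from tendsto_divide[OF tendsto_const[of 1] lim[OF zi this]]
    have "(\<lambda>r. \<phi> (1 / (1 + inverse z ^ r))) \<longlonglongrightarrow> 1"
      by (simp add: abs_value_divide[OF F av] mem[OF zi] subfield_1[OF F] abs_value_1[OF F av])
    moreover have "1 / (1 + inverse z ^ r) = z ^ r / (1 + z ^ r)" for r
    proof -
      have "1 + inverse z ^ r = (1 + z ^ r) / z ^ r" using z0 by (simp add: field_simps)
      then show ?thesis by simp
    qed
    ultimately show ?thesis by simp
  qed
qed

text \<open>The induction familiar from the weak approximation theorem: \<open>z\<close> isolates
  \<psi> from \<open>A\<close>, \<open>u\<close> separates it from the new \<rho>, and the two are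
  combined in a product according to the size of \<open>\<rho> z\<close>.\<close>

lemma extension_isolated:
  assumes K: "subfield K" and F: "subfield F" and KF: "K \<subseteq> F"
    and \<phi>: "abs_value K \<phi>" "nontrivial_av K \<phi>"
    and \<psi>: "\<psi> \<in> extensions K \<phi> F"
    and A: "finite A" "A \<subseteq> extensions K \<phi> F" "\<psi> \<notin> A"
  shows "\<exists>z\<in>F. \<psi> z > 1 \<and> (\<forall>\<rho>\<in>A. \<rho> z < 1)"
  using A
proof (induction A)
  case empty
  obtain a where "a \<in> K" "\<phi> a > 1" using nontrivial_abs_value_gt_1[OF K \<phi>] by blast
  then show ?case using KF extension_eq[OF \<psi>] by (intro bexI[of _ a]) auto
next
  case (insert \<rho> A)
  then obtain z where z: "z \<in> F" "\<psi> z > 1" "\<And>\<eta>. \<eta> \<in> A \<Longrightarrow> \<eta> z < 1" by auto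
  obtain u where u: "u \<in> F" "\<psi> u > 1" "\<rho> u < 1"
    using distinct_extensions_separated[OF K F KF \<phi> \<psi>, of \<rho>] insert.prems by auto
  have av: "abs_value F \<eta>" if "\<eta> \<in> insert \<psi> (insert \<rho> A)" for \<eta>
    using that insert.prems \<psi> extension_abs_value by blast
  note nonneg = abs_value_nonneg[OF av]
  have mult: "\<eta> (x * u) = \<eta> x * \<eta> u" if "\<eta> \<in> insert \<psi> (insert \<rho> A)" "x \<in> F" for \<eta> x
    using abs_value_mult[OF av[OF that(1)] that(2) u(1)] .
  show ?case
  proof (cases "\<rho> z \<le> 1")
    \<comment> \<open>A high power of \<open>z\<close> makes the values on \<open>A\<close> small
      enough to absorb \<open>u\<close>, while at \<rho> it does not enlarge the value of
      \<open>u\<close>.\<close>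
    case True
    have "\<forall>\<^sub>F r in sequentially. \<forall>\<eta>\<in>A. \<eta> z ^ r * \<eta> u < 1"
    proof (rule eventually_ball_finite[OF insert.hyps(1)], rule ballI)
      fix \<eta> assume \<eta>: "\<eta> \<in> A"
      have "(\<lambda>r. \<eta> z ^ r * \<eta> u) \<longlonglongrightarrow> 0 * \<eta> u"
        using z(3)[OF \<eta>] nonneg[of \<eta> z] \<eta> by (intro tendsto_intros LIMSEQ_power_zero) auto
      then show "\<forall>\<^sub>F r in sequentially. \<eta> z ^ r * \<eta> u < 1" by (rule order_tendstoD) simp
    qed
    then obtain r where r: "\<And>\<eta>. \<eta> \<in> A \<Longrightarrow> \<eta> z ^ r * \<eta> u < 1"
      by (auto simp: eventually_sequentially)
    have "\<psi> z ^ r * \<psi> u > 1"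
      using u(2) one_le_power[of "\<psi> z" r] z(2) less_1_mult'[of "\<psi> u" "\<psi> z ^ r"]
      by (simp add: mult.commute)
    moreover have "\<rho> z ^ r * \<rho> u \<le> 1 * \<rho> u"
      using True nonneg by (intro mult_right_mono power_le_one) auto
    ultimately show ?thesis using r u(3) z(1)
      by (intro bexI[of _ "z ^ r * u"])
        (auto simp: mult subfield_power[OF F] abs_value_power[OF F] av subfield_mult[OF F] u(1))
  next
    case False
    \<comment> \<open>Powers of \<open>z\<close> would grow at \<rho>. This quotient tends to 1 at
      \<psi> and \<rho> and to 0 on \<open>A\<close>, so multiplication by it suppresses
      \<open>u\<close> on \<open>A\<close> and hardly changes its value at \<psi> and
      \<rho>.\<close>
    define q where "q = (\<lambda>r::nat. z ^ r / (1 + z ^ r))"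
    have q: "q r \<in> F" for r
      unfolding q_def
      by (intro subfield_divide[OF F] subfield_add[OF F] subfield_power[OF F] subfield_1[OF F] z(1))
    have lim: "(\<lambda>r. \<eta> (q r * u)) \<longlonglongrightarrow> l * \<eta> u"
      if "\<eta> \<in> insert \<psi> (insert \<rho> A)" "(\<lambda>r. \<eta> (q r)) \<longlonglongrightarrow> l" for \<eta> l
      using that q by (simp add: mult tendsto_mult_right)
    have "\<forall>\<^sub>F r in sequentially. \<forall>\<eta>\<in>A. \<eta> (q r * u) < 1"
    proof (rule eventually_ball_finite[OF insert.hyps(1)], rule ballI)
      fix \<eta> assume \<eta>: "\<eta> \<in> A"
      show "\<forall>\<^sub>F r in sequentially. \<eta> (q r * u) < 1"
        using lim[of \<eta> 0] tendsto_abs_value_quotient_0[OF F av z(1), of \<eta>] z(3) \<eta>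
        by (intro order_tendstoD(2)[of _ 0]) (auto simp: q_def)
    qed
    moreover have "\<forall>\<^sub>F r in sequentially. \<psi> (q r * u) > 1"
      using lim[of \<psi> 1] tendsto_abs_value_quotient_1[OF F av z(1), of \<psi>] z(2) u(2)
      by (intro order_tendstoD(1)[of _ "\<psi> u"]) (auto simp: q_def)
    moreover have "\<forall>\<^sub>F r in sequentially. \<rho> (q r * u) < 1"
      using lim[of \<rho> 1] tendsto_abs_value_quotient_1[OF F av z(1), of \<rho>] False u(3)
      by (intro order_tendstoD(2)[of _ "\<rho> u"]) (auto simp: q_def)
    ultimately have "\<forall>\<^sub>F r in sequentially. \<psi> (q r * u) > 1 \<and> (\<forall>\<eta>\<in>insert \<rho> A. \<eta> (q r * u) < 1)"
      by eventually_elim auto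
    then obtain r where "\<psi> (q r * u) > 1 \<and> (\<forall>\<eta>\<in>insert \<rho> A. \<eta> (q r * u) < 1)"
      by (auto simp: eventually_sequentially)
    then show ?thesis using subfield_mult[OF F q u(1)] by blast
  qed
qed

text \<open>Elements that are large at exactly one extension are linearly independent over the
  rationals, so the degree bounds the number of extensions.\<close>

lemma finite_extensions_Rats:
  assumes L: "number_field L" and p: "abs_value \<rat> p" "nontrivial_av \<rat> p"
  shows "finite (extensions \<rat> p L)"
proof -
  note F = number_field_subfield[OF L]
  note RF = Rats_subset_subfield[OF F]
  obtain B where B: "finite B" "L = rat_vec.span B" using L by (rule number_field_spanE)
  have "card A \<le> card B" if A: "A \<subseteq> extensions \<rat> p L" "finite A" for A
  proof (rule ccontr)
    assume "\<not> card A \<le> card B"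
    then have card: "card B < card A" by simp
    then have m: "real (card A) > 0" by linarith
    have av: "abs_value L \<eta>" if "\<eta> \<in> A" for \<eta> using that A extension_abs_value by blast
    \<comment> \<open>The threshold is chosen so that even \<open>card A\<close> values below it add
      up to at most 1.\<close>
    have "\<exists>b\<in>L. \<psi> b > 1 \<and> (\<forall>\<rho>\<in>A - {\<psi>}. \<rho> b < 1 / card A)" if \<psi>: "\<psi> \<in> A" for \<psi>
    proof -
      obtain z where z: "z \<in> L" "\<psi> z > 1" "\<forall>\<rho>\<in>A - {\<psi>}. \<rho> z < 1"
        using extension_isolated[OF subfield_Rats F RF p, of \<psi> "A - {\<psi>}"] A \<psi> by auto
      have "\<forall>\<^sub>F r in sequentially. \<forall>\<rho>\<in>A - {\<psi>}. \<rho> z ^ r < 1 / card A"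
      proof (rule eventually_ball_finite, use A in simp, rule ballI)
        fix \<rho> assume \<rho>: "\<rho> \<in> A - {\<psi>}"
        then have "(\<lambda>r. \<rho> z ^ r) \<longlonglongrightarrow> 0"
          using z(3) abs_value_nonneg[OF av, of \<rho> z] by (intro LIMSEQ_power_zero) auto
        then show "\<forall>\<^sub>F r in sequentially. \<rho> z ^ r < 1 / card A"
          using m by (intro order_tendstoD(2)[of _ 0]) auto
      qed
      \<comment> \<open>The exponent 0 would give the value 1 at \<psi>, which must be
        exceeded.\<close>
      moreover have "\<forall>\<^sub>F r in sequentially. r > (0::nat)" by (rule eventually_gt_at_top)
      ultimately have "\<forall>\<^sub>F r in sequentially. r > 0 \<and> (\<forall>\<rho>\<in>A - {\<psi>}. \<rho> z ^ r < 1 / card A)"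
        by eventually_elim auto
      then obtain r where "r > 0" "\<forall>\<rho>\<in>A - {\<psi>}. \<rho> z ^ r < 1 / card A"
        by (auto simp: eventually_sequentially)
      then show ?thesis using z \<psi>
        by (intro bexI[of _ "z ^ r"])
          (auto simp: abs_value_power[OF F] av subfield_power[OF F] one_less_power)
    qed
    then obtain b where b: "\<And>\<psi>. \<psi> \<in> A \<Longrightarrow> b \<psi> \<in> L" "\<And>\<psi>. \<psi> \<in> A \<Longrightarrow> \<psi> (b \<psi>) > 1"
      "\<And>\<psi> \<rho>. \<psi> \<in> A \<Longrightarrow> \<rho> \<in> A \<Longrightarrow> \<rho> \<noteq> \<psi> \<Longrightarrow> \<rho> (b \<psi>) < 1 / card A"
      by (metis DiffI singletonD)
    obtain u where u: "\<exists>\<psi>\<in>A. u \<psi> \<noteq> 0" "(\<Sum>\<psi>\<in>A. of_rat (u \<psi>) * b \<psi>) = 0"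
      using rat_family_dependent[OF B(1) A(2) card, of b] b(1) B(2) by auto
    \<comment> \<open>The coefficients are rational, so every extension gives them the same value.
      At the extension \<psi> belonging to a coefficient of largest value, its own term exceeds
      \<open>c \<psi>\<close>, while all the others together do not.\<close>
    define c where "c = (\<lambda>\<psi>. p (of_rat (u \<psi>)))"
    have "A \<noteq> {}" using u(1) by auto
    then have "Max (c ` A) \<in> c ` A" using A(2) by (intro Max_in) auto
    then obtain \<psi> where \<psi>: "\<psi> \<in> A" "c \<psi> = Max (c ` A)" by auto
    have max: "c \<rho> \<le> c \<psi>" if "\<rho> \<in> A" for \<rho> using that \<psi> A(2) by simp
    have c_nonneg: "c \<rho> \<ge> 0" for \<rho> using abs_value_nonneg[OF p(1)] by (simp add: c_def)
    have c_pos: "c \<psi> > 0"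
      using u(1) max abs_value_pos[OF subfield_Rats p(1)]
      by (metis Rats_of_rat c_def less_le_trans of_rat_eq_0_iff)
    have mem: "of_rat (u \<rho>) * b \<rho> \<in> L" if "\<rho> \<in> A" for \<rho>
      using that b(1) by (intro subfield_mult[OF F] subfield_of_rat[OF F])
    have val: "\<psi> (of_rat (u \<rho>) * b \<rho>) = c \<rho> * \<psi> (b \<rho>)" if "\<rho> \<in> A" for \<rho>
      using that \<psi>(1) A(1) b(1) extension_eq[of \<psi> \<rat> p L "of_rat (u \<rho>)"]
      by (auto simp: abs_value_mult[OF av] subfield_of_rat[OF F] c_def)
    have "of_rat (u \<psi>) * b \<psi> = - (\<Sum>\<rho>\<in>A - {\<psi>}. of_rat (u \<rho>) * b \<rho>)"
      using u(2) \<psi>(1) A(2) by (simp add: sum.remove add_eq_0_iff2)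
    then have "\<psi> (of_rat (u \<psi>) * b \<psi>) = \<psi> (\<Sum>\<rho>\<in>A - {\<psi>}. of_rat (u \<rho>) * b \<rho>)"
      using abs_value_minus[OF F av[OF \<psi>(1)] subfield_sum[OF F, of "A - {\<psi>}"]] mem by simp
    then have "c \<psi> * \<psi> (b \<psi>) \<le> (\<Sum>\<rho>\<in>A - {\<psi>}. c \<rho> * \<psi> (b \<rho>))"
      using abs_value_sum[OF F av[OF \<psi>(1)], of "A - {\<psi>}" "\<lambda>\<rho>. of_rat (u \<rho>) * b \<rho>"] mem val \<psi>(1)
      by simp
    also have "\<dots> \<le> (\<Sum>\<rho>\<in>A - {\<psi>}. c \<psi> * (1 / card A))"
      using b(3) \<psi>(1) max c_nonneg abs_value_nonneg[OF av[OF \<psi>(1)]]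
      by (intro sum_mono mult_mono) (auto intro: less_imp_le)
    also have "\<dots> \<le> (\<Sum>\<rho>\<in>A. c \<psi> * (1 / card A))"
      using A(2) c_pos by (intro sum_mono2) auto
    also have "\<dots> = c \<psi>" using m by simp
    finally show False using b(2)[OF \<psi>(1)] c_pos by simp
  qed
  then show ?thesis using finite_if_finite_subsets_card_bdd by blast
qed

text \<open>Fewer values are prescribed over the rationals, so finiteness proved there carries over
  to every \<open>K\<close>.\<close>

lemma extensions_subset_Rats:
  "\<rat> \<subseteq> K \<Longrightarrow> extensions K \<phi> F \<subseteq> extensions \<rat> (restr \<rat> \<phi>) F"
  using restr_restr by (auto simp: extensions_def)

section \<open>Compactness\<close>

text \<open>All possible values at an element of extensions of \<^term>\<open>p\<close>: the factors of a compact box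
  containing every extension.\<close>

definition extension_values :: "absval \<Rightarrow> complex \<Rightarrow> real set" where
  "extension_values p x = insert 0 {\<psi> x | \<psi> L. number_field L \<and> x \<in> L \<and> \<psi> \<in> extensions \<rat> p L}"

lemma restr_extension:
  assumes "subfield L" "K \<subseteq> L" "L \<subseteq> F" "\<psi> \<in> extensions K \<phi> F"
  shows "restr L \<psi> \<in> extensions K \<phi> L"
  using assms abs_value_restr restr_restr by (auto simp: extensions_def)

text \<open>The union over all fields containing \<open>x\<close> stays finite because each
  extension can be restricted to the smallest such field without changing its value at
  \<open>x\<close>.\<close>

lemma finite_extension_values:
  assumes p: "abs_value \<rat> p" "nontrivial_av \<rat> p"
  shows "finite (extension_values p x)"
proof (cases "x \<in> Qbar")
  case True
  then obtain M where M: "number_field M" "x \<in> M" "\<And>F. subfield F \<Longrightarrow> x \<in> F \<Longrightarrow> M \<subseteq> F"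
    using simple_number_field by metis
  have "extension_values p x \<subseteq> insert 0 ((\<lambda>\<psi>. \<psi> x) ` extensions \<rat> p M)"
  proof
    fix r assume "r \<in> extension_values p x"
    then consider "r = 0" | \<psi> L where "r = \<psi> x" "number_field L" "x \<in> L" "\<psi> \<in> extensions \<rat> p L"
      by (auto simp: extension_values_def)
    then show "r \<in> insert 0 ((\<lambda>\<psi>. \<psi> x) ` extensions \<rat> p M)"
    proof cases
      case 2
      then have "restr M \<psi> \<in> extensions \<rat> p M"
        using M number_field_subfield by (intro restr_extension[of _ _ L] Rats_subset_subfield) auto
      moreover have "r = restr M \<psi> x" using 2 M by (simp add: restr_def)
      ultimately show ?thesis by blast
    qed simp
  qed
  then show ?thesis using finite_extensions_Rats[OF M(1) p] finite_subset by blast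
next
  case False
  then have "extension_values p x = {0}"
    using number_field_subset_Qbar by (auto simp: extension_values_def)
  then show ?thesis by simp
qed

lemma compact_Pi_extension_values:
  assumes "abs_value \<rat> p" "nontrivial_av \<rat> p"
  shows "compact (Pi UNIV (extension_values p))"
proof -
  have "compactin (product_topology (\<lambda>_. euclidean) UNIV) (PiE UNIV (extension_values p))"
    unfolding compactin_PiE
    using finite_extension_values[OF assms] by (auto intro: finite_imp_compact)
  then show ?thesis by (simp add: euclidean_product_topology PiE_UNIV_domain Pi_def)
qed

text \<open>Equality with a fixed function is an intersection of conditions on single coordinates;
  finiteness of \<open>H\<close> keeps the union closed. This gives both the closed conditions
  cutting out the extensions and, by complement, the open preimages of the basic sets of
  places.\<close>

lemma closed_restr_in_finite:
  assumes "finite H"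
  shows "closed {\<psi>. restr L \<psi> \<in> H}"
proof -
  have "closed {\<psi>. restr L \<psi> = h}" for h
  proof -
    have "continuous_on UNIV (\<lambda>\<psi>. restr L \<psi> x)" for x
      by (cases "x \<in> L") (simp_all add: restr_def)
    then have "closed {\<psi>. \<forall>x. restr L \<psi> x = h x}"
      by (intro closed_Collect_all closed_Collect_eq) simp_all
    then show ?thesis by (simp add: fun_eq_iff)
  qed
  moreover have "{\<psi>. restr L \<psi> \<in> H} = (\<Union>h\<in>H. {\<psi>. restr L \<psi> = h})" by auto
  ultimately show ?thesis using assms closed_UN[of H "\<lambda>h. {\<psi>. restr L \<psi> = h}"] by simp
qed

text \<open>Nontriviality is required on the rationals because \<open>finite_extensions_Rats\<close>
  starts there; \<open>MK_nontrivial\<close> supplies it for the places above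
  \<open>S\<close>.\<close>

context
  fixes K \<phi>
  assumes K: "number_field K" and \<phi>: "abs_value K \<phi>" and nontriv: "nontrivial_av \<rat> (restr \<rat> \<phi>)"
begin

lemma restr_Rats_abs_value: "abs_value \<rat> (restr \<rat> \<phi>)"
  using abs_value_restr[OF subfield_Rats] Rats_subset_subfield number_field_subfield K \<phi> by blast

lemma extensions_subset_extensions_Rats: "extensions K \<phi> F \<subseteq> extensions \<rat> (restr \<rat> \<phi>) F"
  using extensions_subset_Rats Rats_subset_subfield number_field_subfield K by blast

lemma finite_extensions:
  assumes "number_field L"
  shows "finite (extensions K \<phi> L)"
  using finite_extensions_Rats[OF assms restr_Rats_abs_value nontriv]
  by (rule finite_subset[OF extensions_subset_extensions_Rats])

text \<open>Being an absolute value on \<open>Qbar\<close> is a condition on number fields only,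
  since every pair of elements lies in one. The box adds the value 0 outside \<open>Qbar\<close>,
  where its factors are {0}. In this form the set is visibly a closed subset of a compact
  one.\<close>

lemma extensions_Qbar_eq:
  "extensions K \<phi> Qbar = Pi UNIV (extension_values (restr \<rat> \<phi>))
    \<inter> (\<Inter>L\<in>{L. number_field L \<and> K \<subseteq> L}. {\<psi>. restr L \<psi> \<in> extensions K \<phi> L})"
proof (intro equalityI subsetI)
  fix \<psi> assume \<psi>: "\<psi> \<in> extensions K \<phi> Qbar"
  have 1: "restr L \<psi> \<in> extensions K \<phi> L" if "number_field L" "K \<subseteq> L" for L
    by (rule restr_extension[OF number_field_subfield[OF that(1)] that(2)
          number_field_subset_Qbar[OF that(1)] \<psi>])
  have "\<psi> x \<in> extension_values (restr \<rat> \<phi>) x" for x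
  proof (cases "x \<in> Qbar")
    case True
    then obtain L where L: "number_field L" "K \<subseteq> L" "x \<in> L"
      using Qbar_common_number_field[OF K] by metis
    then have "restr L \<psi> \<in> extensions \<rat> (restr \<rat> \<phi>) L" "\<psi> x = restr L \<psi> x"
      using 1 extensions_subset_extensions_Rats by (auto simp: restr_def)
    with L show ?thesis unfolding extension_values_def by blast
  next
    case False
    then show ?thesis
      using abs_value_outside[OF extension_abs_value[OF \<psi>]] by (simp add: extension_values_def)
  qed
  then show "\<psi> \<in> Pi UNIV (extension_values (restr \<rat> \<phi>))
    \<inter> (\<Inter>L\<in>{L. number_field L \<and> K \<subseteq> L}. {\<psi>. restr L \<psi> \<in> extensions K \<phi> L})"
    using 1 by auto
next
  fix \<psi> assume "\<psi> \<in> Pi UNIV (extension_values (restr \<rat> \<phi>))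
    \<inter> (\<Inter>L\<in>{L. number_field L \<and> K \<subseteq> L}. {\<psi>. restr L \<psi> \<in> extensions K \<phi> L})"
  then have val: "\<And>x. \<psi> x \<in> extension_values (restr \<rat> \<phi>) x"
    and res: "\<And>L. number_field L \<Longrightarrow> K \<subseteq> L \<Longrightarrow> restr L \<psi> \<in> extensions K \<phi> L" by auto
  have loc: "\<psi> x \<ge> 0 \<and> (\<psi> x = 0 \<longleftrightarrow> x = 0) \<and> \<psi> (x * y) = \<psi> x * \<psi> y \<and> \<psi> (x + y) \<le> \<psi> x + \<psi> y"
    if xy: "x \<in> Qbar" "y \<in> Qbar" for x y
  proof -
    obtain L where L: "number_field L" "K \<subseteq> L" "x \<in> L" "y \<in> L"
      using Qbar_common_number_field[OF K xy] by blast
    note av = extension_abs_value[OF res[OF L(1,2)]]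
    note F = number_field_subfield[OF L(1)]
    show ?thesis
      using abs_value_nonneg[OF av, of x] abs_value_eq_0[OF av L(3)] abs_value_mult[OF av L(3,4)]
        abs_value_add[OF av L(3,4)] L subfield_mult[OF F L(3,4)] subfield_add[OF F L(3,4)]
      by (simp add: restr_def)
  qed
  have "\<psi> x = 0" if "x \<notin> Qbar" for x
    using val[of x] that number_field_subset_Qbar by (auto simp: extension_values_def)
  then have "abs_value Qbar \<psi>" unfolding abs_value_def using loc by blast
  moreover have "restr K \<psi> = \<phi>"
    using res[OF K order_refl] restr_restr[of K K \<psi>] by (simp add: extensions_def)
  ultimately show "\<psi> \<in> extensions K \<phi> Qbar" by (simp add: extensions_def)
qed

lemma closed_restr_in_extensions: "number_field L \<Longrightarrow> closed {\<psi>. restr L \<psi> \<in> extensions K \<phi> L}"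
  by (intro closed_restr_in_finite finite_extensions)

lemma compact_extensions_Qbar: "compact (extensions K \<phi> Qbar)"
  unfolding extensions_Qbar_eq
  by (intro compact_Int_closed compact_Pi_extension_values closed_INT ballI
      restr_Rats_abs_value nontriv closed_restr_in_extensions) simp

text \<open>By the finite intersection property only finitely many fields have to be treated at
  once, and for these any extension to a compositum is a common witness.\<close>

lemma extensions_Qbar_nonempty:
  assumes ne: "\<And>L. number_field L \<Longrightarrow> K \<subseteq> L \<Longrightarrow> extensions K \<phi> L \<noteq> {}"
  shows "extensions K \<phi> Qbar \<noteq> {}"
  unfolding extensions_Qbar_eq
proof (rule compact_imp_fip)
  show "compact (Pi UNIV (extension_values (restr \<rat> \<phi>)))"
    by (intro compact_Pi_extension_values restr_Rats_abs_value nontriv)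
  show "closed T" if "T \<in> (\<lambda>L. {\<psi>. restr L \<psi> \<in> extensions K \<phi> L}) ` {L. number_field L \<and> K \<subseteq> L}" for T
    using that closed_restr_in_extensions by auto
  fix \<T> assume "finite \<T>"
    "\<T> \<subseteq> (\<lambda>L. {\<psi>. restr L \<psi> \<in> extensions K \<phi> L}) ` {L. number_field L \<and> K \<subseteq> L}"
  then obtain N where N: "finite N" "N \<subseteq> {L. number_field L \<and> K \<subseteq> L}"
    "\<T> = (\<lambda>L. {\<psi>. restr L \<psi> \<in> extensions K \<phi> L}) ` N"
    using finite_subset_image by meson
  then obtain M where M: "number_field M" "\<forall>L\<in>insert K N. L \<subseteq> M"
    using number_field_finite_compositum[of "insert K N"] K by auto
  then obtain \<psi> where \<psi>: "\<psi> \<in> extensions K \<phi> M" using ne by blast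
  \<comment> \<open>The witness lives on \<open>M\<close> and is 0 elsewhere, even at points of
    \<open>Qbar\<close>; it lies in the box because 0 was put into every factor.\<close>
  have "\<psi> x \<in> extension_values (restr \<rat> \<phi>) x" for x
  proof (cases "x \<in> M")
    case True
    moreover have "\<psi> \<in> extensions \<rat> (restr \<rat> \<phi>) M"
      using \<psi> extensions_subset_extensions_Rats by blast
    ultimately show ?thesis using M unfolding extension_values_def by blast
  next
    case False
    then show ?thesis
      using abs_value_outside[OF extension_abs_value[OF \<psi>]] by (simp add: extension_values_def)
  qed
  moreover have "restr L \<psi> \<in> extensions K \<phi> L" if "L \<in> N" for L
    using that N(2) M(2) \<psi> number_field_subfield by (intro restr_extension[of L K M]) auto
  ultimately have "\<psi> \<in> Pi UNIV (extension_values (restr \<rat> \<phi>)) \<inter> \<Inter>\<T>" by (auto simp: N(3))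
  then show "Pi UNIV (extension_values (restr \<rat> \<phi>)) \<inter> \<Inter>\<T> \<noteq> {}" by blast
qed

end

section \<open>The basic open sets of the space of places\<close>

lemma Rats_subset_number_field: "number_field K \<Longrightarrow> \<rat> \<subseteq> K"
  using Rats_subset_subfield number_field_subfield by blast

lemma openin_Yset: "number_field K \<Longrightarrow> v \<in> places K \<Longrightarrow> openin Ytop (Yset K v)"
  unfolding Ytop_def by (intro topology_generated_by_Basis) blast

text \<open>The set is the image under \<open>av_class\<close> of the compact set of extensions to
  \<open>Qbar\<close>, and continuity has to be tested on the generators of \<open>Ytop\<close>
  only.\<close>

lemma compactin_Yset:
  assumes K: "number_field K" and v: "v \<in> places K" "\<phi> \<in> v"
    and nontriv: "nontrivial_av \<rat> (restr \<rat> \<phi>)"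
  shows "compactin Ytop (Yset K v)"
proof -
  let ?E = "extensions K \<phi> Qbar"
  note \<phi> = place_abs_value[OF v]
  have Y: "av_class Qbar ` ?E = Yset K v"
    using bij_betw_extensions_places_above[OF number_field_subfield[OF K] subfield_Qbar
        number_field_subset_Qbar[OF K] v]
    by (simp add: bij_betw_def Yset_def Yall_def)
  have "continuous_map (top_of_set ?E) Ytop (av_class Qbar)"
    unfolding Ytop_def
  proof (rule continuous_on_generated_topo)
    show "av_class Qbar ` topspace (top_of_set ?E)
        \<subseteq> \<Union> {Yset K v | K v. number_field K \<and> v \<in> places K}"
      using Y K v by auto
    fix U assume "U \<in> {Yset K v | K v. number_field K \<and> v \<in> places K}"
    then obtain L w where L: "number_field L" "w \<in> places L" "U = Yset L w" by blast
    \<comment> \<open>As a class of absolute values, \<open>w\<close> is infinite. But the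
      restrictions to \<open>L\<close> in question all extend one absolute value of the rationals,
      so lying in \<open>w\<close> amounts to avoiding the finite set \<open>H\<close>, which is an
      open condition.\<close>
    define H where "H = extensions \<rat> (restr \<rat> \<phi>) L - w"
    have fin: "finite (extensions \<rat> (restr \<rat> \<phi>) L)"
      by (rule finite_extensions_Rats[OF L(1) restr_Rats_abs_value[OF K \<phi> nontriv] nontriv])
    have "av_class Qbar \<psi> \<in> Yset L w \<longleftrightarrow> restr L \<psi> \<notin> H" if \<psi>: "\<psi> \<in> ?E" for \<psi>
    proof -
      have y: "av_class Qbar \<psi> \<in> places Qbar" using \<psi> Y by (auto simp: Yset_def Yall_def)
      have "av_class Qbar \<psi> \<in> Yset L w \<longleftrightarrow> restr L \<psi> \<in> w"
        using divides_iff[OF number_field_subfield[OF L(1)] number_field_subset_Qbar[OF L(1)] y L(2)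
            av_class_self[OF extension_abs_value[OF \<psi>]]] y
        by (simp add: Yset_def Yall_def)
      moreover have "\<psi> \<in> extensions \<rat> (restr \<rat> \<phi>) Qbar"
        using \<psi> extensions_subset_extensions_Rats[OF K \<phi> nontriv] by blast
      then have "restr L \<psi> \<in> extensions \<rat> (restr \<rat> \<phi>) L"
        using L(1) by (intro restr_extension[of _ _ Qbar] number_field_subfield
            Rats_subset_number_field number_field_subset_Qbar)
      ultimately show ?thesis by (simp add: H_def)
    qed
    then have "av_class Qbar -` U \<inter> topspace (top_of_set ?E) = ?E \<inter> - {\<psi>. restr L \<psi> \<in> H}"
      using L(3) by auto
    moreover have "open (- {\<psi>. restr L \<psi> \<in> H})"
      using fin by (intro open_Compl closed_restr_in_finite) (simp add: H_def)
    ultimately show "openin (top_of_set ?E) (av_class Qbar -` U \<inter> topspace (top_of_set ?E))"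
      by (simp add: openin_open_Int)
  qed
  moreover have "compactin (top_of_set ?E) ?E"
    using compact_extensions_Qbar[OF K \<phi> nontriv] by (simp add: compactin_subtopology)
  ultimately show ?thesis using image_compactin[of "top_of_set ?E" ?E Ytop "av_class Qbar"] Y by simp
qed

lemma Yset_disjoint:
  assumes "number_field K" "v \<in> places K" "v' \<in> places K" "y \<in> Yset K v" "y \<in> Yset K v'"
  shows "v = v'"
  using divides_unique[OF number_field_subfield number_field_subset_Qbar, of K y v v'] assms
  by (simp add: Yset_def Yall_def)

lemma Yset_mono:
  assumes "number_field K" "number_field L" "K \<subseteq> L" "v \<in> places K" "w \<in> places L" "divides K w v"
  shows "Yset L w \<subseteq> Yset K v"
  using divides_trans_iff[of K L Qbar _ w v] assms number_field_subfield number_field_subset_Qbar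
  by (auto simp: Yset_def Yall_def)

lemma Yset_intermediate:
  assumes "number_field K" "number_field L" "K \<subseteq> L" "v \<in> places K" "y \<in> Yset K v"
  shows "\<exists>w\<in>places L. y \<in> Yset L w \<and> divides K w v"
proof -
  have "y \<in> places Qbar" "divides K y v" using assms(5) by (auto simp: Yset_def Yall_def)
  then obtain w where "w \<in> places L" "divides L y w" "divides K w v"
    using intermediate_place[OF number_field_subfield[OF assms(1)] number_field_subfield[OF assms(2)]
        assms(3) number_field_subset_Qbar[OF assms(2)] _ assms(4)] by blast
  then show ?thesis using assms(5) by (auto simp: Yset_def)
qed

lemma Yset_decompose:
  assumes "number_field K" "number_field L" "K \<subseteq> L" "v \<in> places K"
  shows "Yset K v = (\<Union>w\<in>{w \<in> places L. divides K w v}. Yset L w)"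
proof (intro equalityI subsetI)
  fix y assume "y \<in> Yset K v"
  then show "y \<in> (\<Union>w\<in>{w \<in> places L. divides K w v}. Yset L w)"
    using Yset_intermediate[OF assms] by blast
next
  fix y assume "y \<in> (\<Union>w\<in>{w \<in> places L. divides K w v}. Yset L w)"
  then obtain w where "w \<in> places L" "divides K w v" "y \<in> Yset L w" by blast
  then show "y \<in> Yset K v" using Yset_mono[OF assms] by auto
qed

text \<open>For the intersection of two basic sets pass to a compositum.\<close>

lemma Yset_base:
  assumes "openin Ytop U" "x \<in> U"
  shows "\<exists>K v. number_field K \<and> v \<in> places K \<and> x \<in> Yset K v \<and> Yset K v \<subseteq> U"
proof -
  have "generate_topology_on {Yset K v | K v. number_field K \<and> v \<in> places K} U"
    using assms(1) by (simp add: Ytop_def openin_topology_generated_by_iff)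
  then show ?thesis using assms(2)
  proof (induction U)
    case (Int A B)
    then obtain K v L w where
      K: "number_field K" "v \<in> places K" "x \<in> Yset K v" "Yset K v \<subseteq> A" and
      L: "number_field L" "w \<in> places L" "x \<in> Yset L w" "Yset L w \<subseteq> B" by (metis IntE)
    obtain M where M: "number_field M" "K \<subseteq> M" "L \<subseteq> M"
      using number_field_compositum[OF K(1) L(1)] by blast
    obtain u where u: "u \<in> places M" "x \<in> Yset M u" "divides K u v"
      using Yset_intermediate[OF K(1) M(1,2) K(2,3)] by blast
    obtain u' where u': "u' \<in> places M" "x \<in> Yset M u'" "divides L u' w"
      using Yset_intermediate[OF L(1) M(1,3) L(2,3)] by blast
    have "u' = u" by (rule Yset_disjoint[OF M(1) u'(1) u(1) u'(2) u(2)])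
    then have "Yset M u \<subseteq> A \<inter> B"
      using Yset_mono[OF K(1) M(1,2) K(2) u(1,3)] Yset_mono[OF L(1) M(1,3) L(2), of u] u' K(4) L(4)
      by auto
    then show ?case using M u by blast
  next
    case (UN \<K>)
    then obtain A where "A \<in> \<K>" "x \<in> A" by blast
    with UN.IH[of A] show ?case by blast
  next
    case (Basis A)
    then show ?case by blast
  qed simp
qed

section \<open>Locally constant functions with compact support\<close>

text \<open>The index set of the sum in \<open>Phi\<close>: places of \<open>K\<close>, not points.
  A place with empty \<open>Yset K v\<close> never belongs to it.\<close>

definition supp :: "place set \<Rightarrow> complex set \<Rightarrow> (place \<Rightarrow> real) \<Rightarrow> place set" where
  "supp S K f = {v \<in> MK S K. \<exists>y\<in>Yset K v. f y \<noteq> 0}"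

text \<open>\<open>Phi\<close> with a prescribed field in place of the chosen one, so that
  independence of the field can be stated.\<close>

definition Phi_at :: "place set \<Rightarrow> complex set \<Rightarrow> (complex set \<Rightarrow> place \<Rightarrow> real) \<Rightarrow> (place \<Rightarrow> real) \<Rightarrow> real"
  where "Phi_at S K c f = (\<Sum>v\<in>supp S K f. c K v * fval K f v)"

lemma Phi_add: "Phi S (\<lambda>K v. c K v + d K v) f = Phi S c f + Phi S d f"
  by (simp add: Phi_def Let_def sum.distrib algebra_simps)

lemma Phi_scale: "Phi S (\<lambda>K v. a * c K v) f = a * Phi S c f"
  by (simp add: Phi_def Let_def sum_distrib_left algebra_simps)

lemma adapted_number_field: "adapted S K f \<Longrightarrow> number_field K"
  and adapted_finite: "adapted S K f \<Longrightarrow> finite (supp S K f)"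
  by (simp_all add: adapted_def supp_def)

lemma adapted_const:
  assumes "adapted S K f" "v \<in> MK S K" "y \<in> Yset K v" "y' \<in> Yset K v"
  shows "f y = f y'"
proof -
  have "\<forall>v\<in>MK S K. \<forall>y\<in>Yset K v. \<forall>y'\<in>Yset K v. f y = f y'"
    using assms(1) unfolding adapted_def by (elim conjE)
  from this[rule_format, OF assms(2-4)] show ?thesis .
qed

lemma adaptedI:
  assumes "number_field K" "finite (supp S K f)"
    and "\<And>v y y'. v \<in> MK S K \<Longrightarrow> y \<in> Yset K v \<Longrightarrow> y' \<in> Yset K v \<Longrightarrow> f y = f y'"
  shows "adapted S K f"
  unfolding adapted_def using assms(1) assms(2)[unfolded supp_def] assms(3) by (intro conjI ballI)

lemma fval_eq:
  assumes "adapted S K f" "v \<in> MK S K" "y \<in> Yset K v"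
  shows "fval K f v = f y"
  unfolding fval_def
  by (rule adapted_const[OF assms(1,2) someI[of "\<lambda>y. y \<in> Yset K v", OF assms(3)] assms(3)])

lemma MK_place: "v \<in> MK S K \<Longrightarrow> v \<in> places K"
  by (simp add: MK_def)

lemma consistent_sum:
  assumes "c \<in> Jstar S" "number_field K" "number_field L" "K \<subseteq> L" "v \<in> MK S K"
  shows "c K v = (\<Sum>w\<in>{w \<in> places L. divides K w v}. c L w)"
proof -
  have "\<forall>(K, v)\<in>Jset S. \<forall>L. number_field L \<and> K \<subseteq> L \<longrightarrow>
      c K v = (\<Sum>w\<in>{w \<in> places L. divides K w v}. c L w)"
    using assms(1) unfolding Jstar_def consistent_def mem_Collect_eq by (elim conjE)
  moreover have "(K, v) \<in> Jset S" using assms(2,5) by (simp add: Jset_def)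
  ultimately show ?thesis using assms(3,4) by (auto dest!: bspec)
qed

section \<open>Places and functions above the fixed set \<open>S\<close>\<close>

context
  fixes S :: "place set"
  assumes S: "S \<subseteq> places \<rat>"
begin

lemma MK_nontrivial:
  assumes "number_field K" "v \<in> MK S K" "\<phi> \<in> v"
  shows "nontrivial_av \<rat> (restr \<rat> \<phi>)"
proof -
  obtain s where "s \<in> places \<rat>" "divides \<rat> v s" "v \<in> places K" using assms(2) S by (auto simp: MK_def)
  then show ?thesis
    using divides_iff[OF subfield_Rats Rats_subset_number_field[OF assms(1)], of v s \<phi>] assms(3)
      place_nontrivial by blast
qed

lemma MK_above:
  assumes "number_field K" "number_field L" "K \<subseteq> L" "v \<in> MK S K" "w \<in> places L" "divides K w v"
  shows "w \<in> MK S L"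
proof -
  obtain s where s: "s \<in> S" "s \<in> places \<rat>" "divides \<rat> v s" using assms(4) S by (auto simp: MK_def)
  then have "divides \<rat> w s"
    using divides_trans_iff[of \<rat> K L w v s] assms MK_place subfield_Rats number_field_subfield
      Rats_subset_number_field by simp
  then show ?thesis using s assms(5) by (auto simp: MK_def)
qed

lemma finite_places_above:
  assumes "number_field K" "number_field L" "K \<subseteq> L" "v \<in> MK S K"
  shows "finite {w \<in> places L. divides K w v}"
proof -
  obtain \<phi> where \<phi>: "\<phi> \<in> v" using place_nonempty[OF MK_place[OF assms(4)]] .
  have "finite (extensions K \<phi> L)"
    using finite_extensions[OF assms(1) place_abs_value[OF MK_place[OF assms(4)] \<phi>]
        MK_nontrivial[OF assms(1,4) \<phi>] assms(2)] .
  then show ?thesis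
    using bij_betw_finite[OF bij_betw_extensions_places_above[OF number_field_subfield[OF assms(1)]
          number_field_subfield[OF assms(2)] assms(3) MK_place[OF assms(4)] \<phi>]] by simp
qed

text \<open>The contrapositive of \<open>extensions_Qbar_nonempty\<close>, read for places through
  the bijection with extensions.\<close>

lemma Yset_empty_imp_no_places_above:
  assumes "number_field K" "v \<in> MK S K" "Yset K v = {}"
  shows "\<exists>L. number_field L \<and> K \<subseteq> L \<and> {w \<in> places L. divides K w v} = {}"
proof (rule ccontr)
  assume *: "\<not> ?thesis"
  obtain \<phi> where \<phi>: "\<phi> \<in> v" using place_nonempty[OF MK_place[OF assms(2)]] .
  note bij = bij_betw_extensions_places_above[OF number_field_subfield[OF assms(1)] _ _
      MK_place[OF assms(2)] \<phi>]
  have "extensions K \<phi> Qbar \<noteq> {}"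
  proof (rule extensions_Qbar_nonempty[OF assms(1) place_abs_value[OF MK_place[OF assms(2)] \<phi>]
        MK_nontrivial[OF assms(1,2) \<phi>]])
    fix L assume L: "number_field L" "K \<subseteq> L"
    then have "{w \<in> places L. divides K w v} \<noteq> {}" using * by blast
    with bij[OF number_field_subfield[OF L(1)] L(2)] show "extensions K \<phi> L \<noteq> {}"
      by (auto simp: bij_betw_def)
  qed
  with bij[OF subfield_Qbar number_field_subset_Qbar[OF assms(1)]] assms(3) show False
    by (auto simp: bij_betw_def Yset_def Yall_def)
qed

lemma Xset_eq:
  assumes K: "number_field K"
  shows "Xset S = (\<Union>v\<in>MK S K. Yset K v)"
proof (intro equalityI subsetI)
  fix y assume "y \<in> Xset S"
  then obtain s where s: "s \<in> S" "s \<in> places \<rat>" "y \<in> Yset \<rat> s"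
    using S by (auto simp: Xset_def Yset_def)
  then obtain v where "v \<in> places K" "y \<in> Yset K v" "divides \<rat> v s"
    using Yset_intermediate[OF number_field_Rats K Rats_subset_number_field[OF K]] by meson
  then show "y \<in> (\<Union>v\<in>MK S K. Yset K v)" using s(1) by (auto simp: MK_def)
next
  fix y assume "y \<in> (\<Union>v\<in>MK S K. Yset K v)"
  then obtain v s where "v \<in> places K" "y \<in> Yset K v" "divides \<rat> v s" "s \<in> S" "s \<in> places \<rat>"
    using S by (auto simp: MK_def)
  then have "y \<in> Yset \<rat> s"
    using Yset_mono[OF number_field_Rats K Rats_subset_number_field[OF K], of s v] by blast
  with \<open>s \<in> S\<close> show "y \<in> Xset S" by (auto simp: Xset_def Yset_def)
qed

lemma Yset_subset_Xset: "number_field K \<Longrightarrow> v \<in> MK S K \<Longrightarrow> Yset K v \<subseteq> Xset S"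
  using Xset_eq by blast

lemma Yset_meets_Xset:
  assumes "number_field K" "v \<in> places K" "y \<in> Yset K v" "y \<in> Xset S"
  shows "v \<in> MK S K"
proof -
  obtain v' where "v' \<in> MK S K" "y \<in> Yset K v'" using assms(1,4) Xset_eq by blast
  then show ?thesis using Yset_disjoint[of K v v' y] assms MK_place by blast
qed

lemma topspace_Xtop: "topspace (Xtop S) = Xset S"
proof -
  have "Xset S \<subseteq> topspace Ytop"
    using Xset_eq[OF number_field_Rats] openin_subset[OF openin_Yset[OF number_field_Rats]] MK_place
    by blast
  then show ?thesis by (auto simp: Xtop_def)
qed

lemma openin_Xtop_Yset:
  assumes "number_field K" "v \<in> MK S K"
  shows "openin (Xtop S) (Yset K v)"
  using openin_Yset[OF assms(1) MK_place[OF assms(2)]] Yset_subset_Xset[OF assms]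
  unfolding Xtop_def openin_subtopology by blast

lemma compactin_Xtop_Yset:
  assumes "number_field K" "v \<in> MK S K"
  shows "compactin (Xtop S) (Yset K v)"
proof -
  obtain \<phi> where \<phi>: "\<phi> \<in> v" using place_nonempty[OF MK_place[OF assms(2)]] .
  show ?thesis
    using compactin_Yset[OF assms(1) MK_place[OF assms(2)] \<phi> MK_nontrivial[OF assms \<phi>]]
      Yset_subset_Xset[OF assms]
    by (simp add: Xtop_def compactin_subtopology)
qed

text \<open>A place \<open>w\<close> of \<open>L\<close> matters only through the points of
  \<open>Yset L w\<close>. Such a point also lies above some \<open>v\<close> in
  \<open>MK S K\<close>, so constancy on \<open>Yset K v\<close> passes to \<open>Yset L w\<close>,
  and the new support consists of places above the old one, finitely many above each.\<close>

lemma adapted_mono: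
  assumes f: "adapted S K f" and L: "number_field L" "K \<subseteq> L"
  shows "adapted S L f" "supp S L f \<subseteq> (\<Union>v\<in>supp S K f. {w \<in> places L. divides K w v})"
proof -
  note K = adapted_number_field[OF f]
  have below: "\<exists>v\<in>MK S K. Yset L w \<subseteq> Yset K v \<and> divides K w v" if w: "w \<in> MK S L" "y \<in> Yset L w" for w y
  proof -
    have "y \<in> Xset S" using Yset_subset_Xset[OF L(1) w(1)] w(2) by blast
    then obtain v where v: "v \<in> MK S K" "y \<in> Yset K v" using Xset_eq[OF K] by blast
    then obtain w' where "w' \<in> places L" "y \<in> Yset L w'" "divides K w' v"
      using Yset_intermediate[OF K L MK_place[OF v(1)]] by blast
    moreover from this have "w' = w" using Yset_disjoint[OF L(1)] w MK_place by blast
    ultimately show ?thesis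
      using v(1) Yset_mono[OF K L MK_place[OF v(1)] MK_place[OF w(1)]] by blast
  qed
  show sub: "supp S L f \<subseteq> (\<Union>v\<in>supp S K f. {w \<in> places L. divides K w v})"
  proof
    fix w assume "w \<in> supp S L f"
    then obtain y where y: "w \<in> MK S L" "y \<in> Yset L w" "f y \<noteq> 0" by (auto simp: supp_def)
    then obtain v where "v \<in> MK S K" "Yset L w \<subseteq> Yset K v" "divides K w v" using below by blast
    then show "w \<in> (\<Union>v\<in>supp S K f. {w \<in> places L. divides K w v})"
      using y MK_place by (auto simp: supp_def)
  qed
  have "finite (\<Union>v\<in>supp S K f. {w \<in> places L. divides K w v})"
    using adapted_finite[OF f] finite_places_above[OF K L] by (auto simp: supp_def)
  then have "finite (supp S L f)" by (rule finite_subset[OF sub])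
  moreover have "f y = f y'" if w: "w \<in> MK S L" "y \<in> Yset L w" "y' \<in> Yset L w" for w y y'
  proof -
    obtain v where "v \<in> MK S K" "Yset L w \<subseteq> Yset K v" using below w by blast
    then show ?thesis using adapted_const[OF f, of v y y'] w by auto
  qed
  ultimately show "adapted S L f" by (intro adaptedI[OF L(1)])
qed

lemma adapted_common:
  assumes "adapted S K f" "adapted S L g"
  shows "\<exists>M. adapted S M f \<and> adapted S M g \<and> K \<subseteq> M \<and> L \<subseteq> M"
proof -
  obtain M where "number_field M" "K \<subseteq> M" "L \<subseteq> M"
    using number_field_compositum[OF assms[THEN adapted_number_field]] by blast
  then show ?thesis using adapted_mono(1)[OF assms(1)] adapted_mono(1)[OF assms(2)] by blast
qed

lemma locally_constant_nbhd:
  assumes "locally_constant S f" "x \<in> Xset S"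
  shows "\<exists>K v. number_field K \<and> v \<in> MK S K \<and> x \<in> Yset K v \<and> (\<forall>y\<in>Yset K v. f y = f x)"
proof -
  obtain U where U: "openin (Xtop S) U" "x \<in> U" "\<forall>y\<in>U. f y = f x"
    using assms by (auto simp: locally_constant_def)
  then obtain T where T: "openin Ytop T" "U = T \<inter> Xset S"
    by (auto simp: Xtop_def openin_subtopology)
  obtain K v where K: "number_field K" "v \<in> places K" "x \<in> Yset K v" "Yset K v \<subseteq> T"
    using Yset_base[OF T(1), of x] U(2) T(2) by blast
  have v: "v \<in> MK S K" using Yset_meets_Xset[OF K(1-3) assms(2)] .
  have "Yset K v \<subseteq> U" using K(4) T(2) Yset_subset_Xset[OF K(1) v] by blast
  then show ?thesis using K v U(3) by blast
qed

text \<open>Local constancy gives a field for each point, compactness leaves finitely many of them,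
  and their compositum works everywhere. It is enough to cover the closed support, since
  \<open>f\<close> is 0 elsewhere on \<open>Xset S\<close>.\<close>

lemma LCc_imp_adapted:
  assumes "f \<in> LCc S"
  shows "\<exists>K. adapted S K f"
proof -
  define C where "C = Xtop S closure_of {x \<in> Xset S. f x \<noteq> 0}"
  have lc: "locally_constant S f" and C: "compactin (Xtop S) C"
    using assms by (auto simp: LCc_def compact_support_def C_def)
  have CX: "C \<subseteq> Xset S" unfolding C_def using closure_of_subset_topspace topspace_Xtop by metis
  have supp_C: "x \<in> C" if "x \<in> Xset S" "f x \<noteq> 0" for x
    unfolding C_def using that topspace_Xtop
    by (intro subsetD[OF closure_of_subset]) auto
  define \<U> where "\<U> = {Yset K v | K v. number_field K \<and> v \<in> MK S K \<and> (\<exists>a. \<forall>y\<in>Yset K v. f y = a)}"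
  have "C \<subseteq> \<Union>\<U>"
  proof
    fix x assume "x \<in> C"
    then obtain K v where K: "number_field K" "v \<in> MK S K" "x \<in> Yset K v" "\<forall>y\<in>Yset K v. f y = f x"
      using locally_constant_nbhd[OF lc] CX by blast
    then have "Yset K v \<in> \<U>" unfolding \<U>_def by blast
    with K(3) show "x \<in> \<Union>\<U>" by blast
  qed
  moreover have "\<forall>U\<in>\<U>. openin (Xtop S) U" using openin_Xtop_Yset by (auto simp: \<U>_def)
  ultimately obtain \<F> where \<F>: "finite \<F>" "\<F> \<subseteq> \<U>" "C \<subseteq> \<Union>\<F>"
    using C unfolding compactin_def by meson
  have "\<forall>U\<in>\<F>. \<exists>K v a. U = Yset K v \<and> number_field K \<and> v \<in> MK S K \<and> (\<forall>y\<in>U. f y = a)"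
    using \<F>(2) unfolding \<U>_def by fast
  then obtain k p a where kp: "\<And>U. U \<in> \<F> \<Longrightarrow> U = Yset (k U) (p U)" "\<And>U. U \<in> \<F> \<Longrightarrow> number_field (k U)"
    "\<And>U. U \<in> \<F> \<Longrightarrow> p U \<in> MK S (k U)" "\<And>U y. U \<in> \<F> \<Longrightarrow> y \<in> U \<Longrightarrow> f y = a U"
    by metis
  obtain M where M: "number_field M" "\<forall>K\<in>k ` \<F>. K \<subseteq> M"
    using number_field_finite_compositum[of "k ` \<F>"] \<F>(1) kp(2) by auto
  \<comment> \<open>The members of the cover belong to different fields and may overlap. Over
    \<open>M\<close> a basic set that meets \<open>C\<close> lies entirely inside one of
    them.\<close>
  have refine: "\<exists>U\<in>\<F>. Yset M v \<subseteq> U \<and> divides (k U) v (p U)"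
    if v: "v \<in> MK S M" "y \<in> Yset M v" "y \<in> C" for v y
  proof -
    obtain U where U: "U \<in> \<F>" "y \<in> U" using \<F>(3) v(3) by blast
    have kM: "k U \<subseteq> M" using M U by blast
    obtain w where w: "w \<in> places M" "y \<in> Yset M w" "divides (k U) w (p U)"
      using Yset_intermediate[OF kp(2)[OF U(1)] M(1) kM MK_place[OF kp(3)[OF U(1)]], of y]
        kp(1)[OF U(1)] U(2) by blast
    have "w = v" using Yset_disjoint[OF M(1) w(1) MK_place[OF v(1)] w(2) v(2)] .
    moreover have "Yset M w \<subseteq> U"
      using Yset_mono[OF kp(2)[OF U(1)] M(1) kM MK_place[OF kp(3)[OF U(1)]] w(1,3)] kp(1)[OF U(1)]
      by simp
    ultimately show ?thesis using U(1) w(3) by blast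
  qed
  have const: "f y = f y'" if v: "v \<in> MK S M" "y \<in> Yset M v" "y' \<in> Yset M v" for v y y'
  proof (cases "y \<in> C \<or> y' \<in> C")
    case True
    then obtain U where "U \<in> \<F>" "Yset M v \<subseteq> U" using refine[OF v(1)] v(2,3) by blast
    then have "U \<in> \<F>" "y \<in> U" "y' \<in> U" using v(2,3) by auto
    then show ?thesis using kp(4) by metis
  next
    case False
    moreover have "y \<in> Xset S" "y' \<in> Xset S" using Yset_subset_Xset[OF M(1) v(1)] v by auto
    ultimately have "f y = 0" "f y' = 0" using supp_C by blast+
    then show ?thesis by simp
  qed
  have sub: "supp S M f \<subseteq> (\<Union>U\<in>\<F>. {v \<in> places M. divides (k U) v (p U)})"
  proof
    fix v assume "v \<in> supp S M f"
    then obtain y where y: "v \<in> MK S M" "y \<in> Yset M v" "f y \<noteq> 0" by (auto simp: supp_def)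
    then have "y \<in> C" using Yset_subset_Xset[OF M(1)] supp_C by blast
    then show "v \<in> (\<Union>U\<in>\<F>. {v \<in> places M. divides (k U) v (p U)})"
      using refine[OF y(1,2)] MK_place[OF y(1)] by blast
  qed
  have "finite (\<Union>U\<in>\<F>. {v \<in> places M. divides (k U) v (p U)})"
    using \<F>(1) finite_places_above[OF kp(2) M(1) _ kp(3)] M(2) by auto
  then have "finite (supp S M f)" by (rule finite_subset[OF sub])
  then have "adapted S M f" using const by (rule adaptedI[OF M(1)])
  then show ?thesis by blast
qed

text \<open>The set where \<open>f\<close> is nonzero is a finite union of compact basic sets. The
  remaining basic sets for the same \<open>K\<close> make up its complement in
  \<open>Xset S\<close>, so it is already closed and equals its closure.\<close>

lemma adapted_imp_LCc:
  assumes f: "adapted S K f" and out: "\<And>x. x \<notin> Xset S \<Longrightarrow> f x = 0"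
  shows "f \<in> LCc S"
proof -
  note K = adapted_number_field[OF f]
  have "locally_constant S f"
    unfolding locally_constant_def
  proof
    fix x assume "x \<in> Xset S"
    then obtain v where v: "v \<in> MK S K" "x \<in> Yset K v" using Xset_eq[OF K] by blast
    then show "\<exists>U. openin (Xtop S) U \<and> x \<in> U \<and> (\<forall>y\<in>U. f y = f x)"
      using openin_Xtop_Yset[OF K v(1)] adapted_const[OF f v(1) _ v(2)]
      by (intro exI[of _ "Yset K v"] conjI ballI)
  qed
  moreover have "compact_support S f"
  proof -
    have *: "{x \<in> Xset S. f x \<noteq> 0} = (\<Union>v\<in>supp S K f. Yset K v)"
    proof (intro equalityI subsetI)
      fix x assume "x \<in> (\<Union>v\<in>supp S K f. Yset K v)"
      then obtain v y where v: "v \<in> MK S K" "x \<in> Yset K v" "y \<in> Yset K v" "f y \<noteq> 0"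
        by (auto simp: supp_def)
      then have "f x \<noteq> 0" using adapted_const[OF f v(1-3)] by simp
      then show "x \<in> {x \<in> Xset S. f x \<noteq> 0}" using Yset_subset_Xset[OF K v(1)] v(2) by blast
    qed (use Xset_eq[OF K] in \<open>auto simp: supp_def\<close>)
    have "Xset S - (\<Union>v\<in>supp S K f. Yset K v) = (\<Union>v\<in>MK S K - supp S K f. Yset K v)"
    proof (intro equalityI subsetI)
      fix x assume "x \<in> (\<Union>v\<in>MK S K - supp S K f. Yset K v)"
      then obtain v where v: "v \<in> MK S K" "v \<notin> supp S K f" "x \<in> Yset K v" by blast
      then have "x \<notin> Yset K v'" if "v' \<in> supp S K f" for v'
        using that Yset_disjoint[OF K MK_place[OF v(1)], of v' x] MK_place by (auto simp: supp_def)
      then show "x \<in> Xset S - (\<Union>v\<in>supp S K f. Yset K v)"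
        using Yset_subset_Xset[OF K v(1)] v(3) by blast
    qed (use Xset_eq[OF K] in blast)
    moreover have "openin (Xtop S) (\<Union>v\<in>MK S K - supp S K f. Yset K v)"
      using openin_Xtop_Yset[OF K] by auto
    moreover have "(\<Union>v\<in>supp S K f. Yset K v) \<subseteq> Xset S" using * by blast
    ultimately have "closedin (Xtop S) (\<Union>v\<in>supp S K f. Yset K v)"
      by (simp add: closedin_def topspace_Xtop)
    moreover have "compactin (Xtop S) (\<Union>v\<in>supp S K f. Yset K v)"
      using adapted_finite[OF f] compactin_Xtop_Yset[OF K]
      by (intro compactin_Union) (auto simp: supp_def)
    ultimately show ?thesis by (simp add: compact_support_def * closure_of_closedin)
  qed
  ultimately show ?thesis using out by (auto simp: LCc_def)
qed

section \<open>The functional of a consistent map\<close>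

text \<open>In truth \<^term>\<open>Yset K v\<close> is never empty, but compactness alone shows that a consistent map
  vanishes where it is, so no existence theorem for extensions of absolute values is needed.\<close>

lemma consistent_empty:
  assumes "c \<in> Jstar S" "number_field K" "v \<in> MK S K" "Yset K v = {}"
  shows "c K v = 0"
proof -
  obtain L where L: "number_field L" "K \<subseteq> L" "{w \<in> places L. divides K w v} = {}"
    using Yset_empty_imp_no_places_above[OF assms(2-4)] by blast
  show ?thesis using consistent_sum[OF assms(1,2) L(1,2) assms(3)] by (simp only: L(3) sum.empty)
qed

lemma Phi_at_superset:
  assumes f: "adapted S K f" and c: "c \<in> Jstar S" and T: "finite T" "supp S K f \<subseteq> T" "T \<subseteq> MK S K"
  shows "Phi_at S K c f = (\<Sum>v\<in>T. c K v * fval K f v)"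
  unfolding Phi_at_def
proof (rule sum.mono_neutral_left[OF T(1,2)], rule ballI)
  fix v assume v: "v \<in> T - supp S K f"
  then have MK: "v \<in> MK S K" using T(3) by blast
  show "c K v * fval K f v = 0"
  \<comment> \<open>For empty \<open>Yset K v\<close> the number \<open>fval K f v\<close> is the
    value of \<open>f\<close> at an unspecified point, so the product vanishes because of
    \<open>c\<close>, not because of \<open>f\<close>.\<close>
  proof (cases "Yset K v = {}")
    case True
    then show ?thesis using consistent_empty[OF c adapted_number_field[OF f] MK] by simp
  next
    case False
    then obtain y where y: "y \<in> Yset K v" by blast
    then have "f y = 0" using v MK by (auto simp: supp_def)
    then show ?thesis using fval_eq[OF f MK y] by simp
  qed
qed

text \<open>Consistency replaces each \<open>c K v\<close> by the sum over the places above
  \<open>v\<close>; these groups are disjoint for different \<open>v\<close>, and \<open>f\<close>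
  has the same value on the whole group.\<close>

lemma Phi_at_mono:
  assumes f: "adapted S K f" and L: "number_field L" "K \<subseteq> L" and c: "c \<in> Jstar S"
  shows "Phi_at S L c f = Phi_at S K c f"
proof -
  note K = adapted_number_field[OF f]
  let ?W = "\<lambda>v. {w \<in> places L. divides K w v}"
  have MK: "v \<in> MK S K" if "v \<in> supp S K f" for v using that by (simp add: supp_def)
  have fin: "\<forall>v\<in>supp S K f. finite (?W v)" using finite_places_above[OF K L] MK by blast
  have disj: "\<forall>v\<in>supp S K f. \<forall>v'\<in>supp S K f. v \<noteq> v' \<longrightarrow> ?W v \<inter> ?W v' = {}"
  proof (intro ballI impI, rule ccontr)
    fix v v' assume *: "v \<in> supp S K f" "v' \<in> supp S K f" "v \<noteq> v'" "?W v \<inter> ?W v' \<noteq> {}"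
    then obtain w where "w \<in> places L" "divides K w v" "divides K w v'" by blast
    then have "v = v'"
      by (rule divides_unique[OF number_field_subfield[OF K] L(2) _ MK_place[OF MK[OF *(1)]]
            MK_place[OF MK[OF *(2)]]])
    with *(3) show False by contradiction
  qed
  have val: "c L w * fval L f w = c L w * fval K f v" if v: "v \<in> supp S K f" and w: "w \<in> ?W v" for v w
  proof (cases "Yset L w = {}")
    case True
    have "w \<in> MK S L" using MK_above[OF K L MK[OF v]] w by simp
    then show ?thesis using consistent_empty[OF c L(1) _ True] by simp
  next
    case False
    then obtain y where y: "y \<in> Yset L w" by blast
    have "w \<in> MK S L" using MK_above[OF K L MK[OF v]] w by simp
    then have "fval L f w = f y" using fval_eq[OF adapted_mono(1)[OF f L]] y by blast
    moreover have "y \<in> Yset K v" using Yset_mono[OF K L MK_place[OF MK[OF v]], of w] w y by auto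
    then have "fval K f v = f y" by (rule fval_eq[OF f MK[OF v]])
    ultimately show ?thesis by simp
  qed
  \<comment> \<open>The union can exceed \<open>supp S L f\<close> by places whose
    \<open>Yset\<close> is empty, hence the detour through a superset.\<close>
  have "Phi_at S L c f = (\<Sum>w\<in>(\<Union>v\<in>supp S K f. ?W v). c L w * fval L f w)"
  proof (rule Phi_at_superset[OF adapted_mono(1)[OF f L] c])
    show "finite (\<Union>v\<in>supp S K f. ?W v)" using adapted_finite[OF f] fin by blast
    show "supp S L f \<subseteq> (\<Union>v\<in>supp S K f. ?W v)" by (rule adapted_mono(2)[OF f L])
    show "(\<Union>v\<in>supp S K f. ?W v) \<subseteq> MK S L" using MK_above[OF K L MK] by blast
  qed
  also have "\<dots> = (\<Sum>v\<in>supp S K f. \<Sum>w\<in>?W v. c L w * fval L f w)"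
    by (rule sum.UNION_disjoint[OF adapted_finite[OF f] fin disj])
  also have "\<dots> = (\<Sum>v\<in>supp S K f. \<Sum>w\<in>?W v. c L w * fval K f v)"
    using val by (intro sum.cong refl)
  also have "\<dots> = Phi_at S K c f"
    unfolding Phi_at_def sum_distrib_right[symmetric]
    using consistent_sum[OF c K L MK] by (intro sum.cong refl) simp
  finally show ?thesis .
qed

text \<open>Neither \<open>K\<close> nor the field chosen in \<open>Phi\<close> need contain the
  other; both are compared with a compositum.\<close>

lemma Phi_eq:
  assumes f: "f \<in> LCc S" "adapted S K f" and c: "c \<in> Jstar S"
  shows "Phi S c f = Phi_at S K c f"
proof -
  define M where "M = (SOME K. adapted S K f)"
  have M: "adapted S M f" unfolding M_def using f(2) by (rule someI)
  obtain N where N: "number_field N" "K \<subseteq> N" "M \<subseteq> N"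
    using number_field_compositum[OF f(2)[THEN adapted_number_field] M[THEN adapted_number_field]]
    by blast
  have "Phi S c f = Phi_at S M c f"
    using f(1) by (simp add: Phi_def Phi_at_def supp_def M_def Let_def)
  also have "\<dots> = Phi_at S N c f" by (rule Phi_at_mono[OF M N(1,3) c, symmetric])
  also have "\<dots> = Phi_at S K c f" by (rule Phi_at_mono[OF f(2) N(1,2) c])
  finally show ?thesis .
qed

section \<open>Linearity of the functional\<close>

lemma adapted_add:
  assumes "adapted S K f" "adapted S K g"
  shows "adapted S K (\<lambda>x. f x + g x)"
proof (rule adaptedI[OF adapted_number_field[OF assms(1)]])
  have "supp S K (\<lambda>x. f x + g x) \<subseteq> supp S K f \<union> supp S K g" by (auto simp: supp_def)
  then show "finite (supp S K (\<lambda>x. f x + g x))"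
    using adapted_finite[OF assms(1)] adapted_finite[OF assms(2)] by (simp add: finite_subset)
  show "f y + g y = f y' + g y'" if "v \<in> MK S K" "y \<in> Yset K v" "y' \<in> Yset K v" for v y y'
    by (rule arg_cong2[of _ _ _ _ "(+)", OF adapted_const[OF assms(1) that] adapted_const[OF assms(2) that]])
qed

lemma adapted_scale:
  assumes "adapted S K f"
  shows "adapted S K (\<lambda>x. a * f x)"
proof (rule adaptedI[OF adapted_number_field[OF assms(1)]])
  have "supp S K (\<lambda>x. a * f x) \<subseteq> supp S K f" by (auto simp: supp_def)
  then show "finite (supp S K (\<lambda>x. a * f x))"
    using adapted_finite[OF assms(1)] by (simp add: finite_subset)
  show "a * f y = a * f y'" if "v \<in> MK S K" "y \<in> Yset K v" "y' \<in> Yset K v" for v y y'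
    by (rule arg_cong[OF adapted_const[OF assms that]])
qed

lemma LCc_outside: "f \<in> LCc S \<Longrightarrow> x \<notin> Xset S \<Longrightarrow> f x = 0"
  by (simp add: LCc_def)

lemma LCc_common_adapted:
  assumes "f \<in> LCc S" "g \<in> LCc S"
  shows "\<exists>K. adapted S K f \<and> adapted S K g"
proof -
  obtain K L where "adapted S K f" "adapted S L g"
    using LCc_imp_adapted[OF assms(1)] LCc_imp_adapted[OF assms(2)] by blast
  from adapted_common[OF this] show ?thesis by blast
qed

lemma LCc_add:
  assumes "f \<in> LCc S" "g \<in> LCc S"
  shows "(\<lambda>x. f x + g x) \<in> LCc S"
proof -
  obtain K where K: "adapted S K f" "adapted S K g" using LCc_common_adapted[OF assms] by blast
  show ?thesis
    by (rule adapted_imp_LCc[OF adapted_add[OF K]]) (simp add: LCc_outside assms)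
qed

lemma LCc_scale:
  assumes "f \<in> LCc S"
  shows "(\<lambda>x. a * f x) \<in> LCc S"
proof -
  obtain K where K: "adapted S K f" using LCc_imp_adapted[OF assms] by blast
  show ?thesis
    by (rule adapted_imp_LCc[OF adapted_scale[OF K]]) (simp add: LCc_outside assms)
qed

lemma Phi_in_Lstar:
  assumes c: "c \<in> Jstar S"
  shows "Phi S c \<in> Lstar S"
  unfolding Lstar_def mem_Collect_eq
proof (intro conjI ballI allI impI)
  fix f g assume f: "f \<in> LCc S" and g: "g \<in> LCc S"
  obtain K where K: "adapted S K f" "adapted S K g" using LCc_common_adapted[OF f g] by blast
  \<comment> \<open>The support of the sum may be smaller because of cancellation, so all three sums
    are taken over this common index set.\<close>
  let ?T = "supp S K f \<union> supp S K g"
  have T: "finite ?T" "?T \<subseteq> MK S K"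
    using adapted_finite[OF K(1)] adapted_finite[OF K(2)] by (auto simp: supp_def)
  have "Phi S c (\<lambda>x. f x + g x) = (\<Sum>v\<in>?T. c K v * fval K (\<lambda>x. f x + g x) v)"
    unfolding Phi_eq[OF LCc_add[OF f g] adapted_add[OF K] c]
    by (intro Phi_at_superset adapted_add K c T) (auto simp: supp_def)
  also have "\<dots> = (\<Sum>v\<in>?T. c K v * fval K f v) + (\<Sum>v\<in>?T. c K v * fval K g v)"
    by (simp add: fval_def algebra_simps sum.distrib)
  also have "\<dots> = Phi S c f + Phi S c g"
    unfolding Phi_eq[OF f K(1) c] Phi_eq[OF g K(2) c]
    using Phi_at_superset[OF K(1) c T(1) _ T(2)] Phi_at_superset[OF K(2) c T(1) _ T(2)] by simp
  finally show "Phi S c (\<lambda>x. f x + g x) = Phi S c f + Phi S c g" .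
next
  fix a f assume f: "f \<in> LCc S"
  obtain K where K: "adapted S K f" using LCc_imp_adapted[OF f] by blast
  have "Phi S c (\<lambda>x. a * f x) = (\<Sum>v\<in>supp S K f. c K v * fval K (\<lambda>x. a * f x) v)"
    unfolding Phi_eq[OF LCc_scale[OF f] adapted_scale[OF K] c]
    by (intro Phi_at_superset adapted_scale K c adapted_finite) (auto simp: supp_def)
  also have "\<dots> = a * Phi S c f"
    unfolding Phi_eq[OF f K c] by (simp add: Phi_at_def fval_def algebra_simps sum_distrib_left)
  finally show "Phi S c (\<lambda>x. a * f x) = a * Phi S c f" .
qed (simp add: Phi_def)

section \<open>Indicators of basic sets, and bijectivity\<close>

lemma supp_indicator:
  assumes "number_field K" "v \<in> MK S K"
  shows "supp S K (indicator (Yset K v)) \<subseteq> {v}"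
proof
  fix v' assume "v' \<in> supp S K (indicator (Yset K v))"
  then obtain y where "v' \<in> MK S K" "y \<in> Yset K v'" "y \<in> Yset K v"
    by (auto simp: supp_def indicator_def split: if_splits)
  then show "v' \<in> {v}"
    using Yset_disjoint[OF assms(1) MK_place MK_place[OF assms(2)]] by blast
qed

lemma adapted_indicator:
  assumes "number_field K" "v \<in> MK S K"
  shows "adapted S K (indicator (Yset K v))"
proof (rule adaptedI[OF assms(1)])
  show "finite (supp S K (indicator (Yset K v)))"
    using supp_indicator[OF assms] by (rule finite_subset) simp
  fix v' y y' assume v': "v' \<in> MK S K" "y \<in> Yset K v'" "y' \<in> Yset K v'"
  have "y \<in> Yset K v \<longleftrightarrow> v' = v" "y' \<in> Yset K v \<longleftrightarrow> v' = v"
    using v' Yset_disjoint[OF assms(1) MK_place[OF v'(1)] MK_place[OF assms(2)]] by blast+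
  then show "indicator (Yset K v) y = indicator (Yset K v) y'" by (simp add: indicator_def)
qed

lemma indicator_LCc:
  assumes "number_field K" "v \<in> MK S K"
  shows "indicator (Yset K v) \<in> LCc S"
proof (rule adapted_imp_LCc[OF adapted_indicator[OF assms]])
  show "indicator (Yset K v) x = 0" if "x \<notin> Xset S" for x
    using that Yset_subset_Xset[OF assms] by (auto simp: indicator_def)
qed

lemma Phi_indicator:
  assumes c: "c \<in> Jstar S" and K: "number_field K" "v \<in> MK S K"
  shows "Phi S c (indicator (Yset K v)) = c K v"
proof -
  have "Phi S c (indicator (Yset K v)) = (\<Sum>u\<in>{v}. c K u * fval K (indicator (Yset K v)) u)"
    unfolding Phi_eq[OF indicator_LCc[OF K] adapted_indicator[OF K] c]
    using K(2) by (intro Phi_at_superset adapted_indicator K c supp_indicator) auto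
  also have "\<dots> = c K v"
  proof (cases "Yset K v = {}")
    case True
    then show ?thesis using consistent_empty[OF c K] by simp
  next
    case False
    then obtain y where y: "y \<in> Yset K v" by blast
    then show ?thesis using fval_eq[OF adapted_indicator[OF K] K(2) y] by simp
  qed
  finally show ?thesis .
qed

lemma Phi_inj: "inj_on (Phi S) (Jstar S)"
proof (rule inj_onI)
  fix c d assume c: "c \<in> Jstar S" and d: "d \<in> Jstar S" and eq: "Phi S c = Phi S d"
  have "c K v = d K v" for K v
  proof (cases "(K, v) \<in> Jset S")
    case True
    then have "number_field K" "v \<in> MK S K" by (auto simp: Jset_def)
    then show ?thesis using Phi_indicator[OF c] Phi_indicator[OF d] eq by metis
  next
    case False
    then show ?thesis using c d by (simp add: Jstar_def)
  qed
  then show "c = d" by (intro ext)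
qed

lemma LCc_zero: "(\<lambda>x. 0) \<in> LCc S"
  by (rule adapted_imp_LCc[OF adaptedI[OF number_field_Rats]]) (simp_all add: supp_def)

lemma LCc_sum:
  assumes "finite A" "\<And>i. i \<in> A \<Longrightarrow> f i \<in> LCc S"
  shows "(\<lambda>x. \<Sum>i\<in>A. f i x) \<in> LCc S"
  using assms by (induction A) (simp_all add: LCc_zero LCc_add)

lemma
  assumes "l \<in> Lstar S"
  shows Lstar_add: "f \<in> LCc S \<Longrightarrow> g \<in> LCc S \<Longrightarrow> l (\<lambda>x. f x + g x) = l f + l g"
    and Lstar_scale: "f \<in> LCc S \<Longrightarrow> l (\<lambda>x. a * f x) = a * l f"
    and Lstar_outside: "f \<notin> LCc S \<Longrightarrow> l f = 0"
  using assms by (simp_all add: Lstar_def)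

lemma Lstar_sum:
  assumes l: "l \<in> Lstar S" and "finite A" "\<And>i. i \<in> A \<Longrightarrow> f i \<in> LCc S"
  shows "l (\<lambda>x. \<Sum>i\<in>A. f i x) = (\<Sum>i\<in>A. l (f i))"
  using assms(2,3)
proof (induction A)
  case empty
  then show ?case using Lstar_scale[OF l LCc_zero, of 0] by simp
next
  case (insert i A)
  then have "l (\<lambda>x. f i x + (\<Sum>i\<in>A. f i x)) = l (f i) + l (\<lambda>x. \<Sum>i\<in>A. f i x)"
    by (intro Lstar_add[OF l] LCc_sum) auto
  then show ?case using insert by simp
qed

text \<open>The sets \<open>Yset K u\<close> are pairwise disjoint, so only the place below
  \<open>y\<close> can contribute.\<close>

lemma sum_indicator_Yset:
  assumes K: "number_field K" and T: "finite T" "T \<subseteq> places K" and v: "v \<in> places K" "y \<in> Yset K v"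
  shows "(\<Sum>u\<in>T. a u * indicator (Yset K u) y) = (if v \<in> T then a v else (0::real))"
proof -
  have "y \<in> Yset K u \<longleftrightarrow> u = v" if "u \<in> T" for u
    using that T(2) v Yset_disjoint[OF K, of u v y] by blast
  then have "(\<Sum>u\<in>T. a u * indicator (Yset K u) y) = (\<Sum>u\<in>T. if u = v then a u else 0)"
    by (intro sum.cong refl) (simp add: indicator_def)
  also have "\<dots> = (if v \<in> T then a v else 0)" using T(1) by simp
  finally show ?thesis .
qed

lemma indicator_Yset_decompose:
  assumes K: "number_field K" and L: "number_field L" "K \<subseteq> L" and v: "v \<in> MK S K"
  shows "(indicator (Yset K v) :: place \<Rightarrow> real)
    = (\<lambda>y. \<Sum>w\<in>{w \<in> places L. divides K w v}. indicator (Yset L w) y)"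
proof
  fix y
  let ?W = "{w \<in> places L. divides K w v}"
  note W = finite_places_above[OF K L v]
  note dec = Yset_decompose[OF K L MK_place[OF v]]
  show "(indicator (Yset K v) y :: real) = (\<Sum>w\<in>?W. indicator (Yset L w) y)"
  proof (cases "y \<in> Yset K v")
    case True
    then obtain w where w: "w \<in> ?W" "y \<in> Yset L w" using dec by blast
    then have "(\<Sum>w\<in>?W. 1 * indicator (Yset L w) y) = (1::real)"
      using sum_indicator_Yset[OF L(1) W, of w y "\<lambda>_. 1"] by simp
    then show ?thesis using True by simp
  next
    case False
    then have "\<forall>w\<in>?W. y \<notin> Yset L w" using dec by blast
    then show ?thesis using False by simp
  qed
qed

lemma adapted_eq_sum_indicator:
  assumes f: "f \<in> LCc S" "adapted S K f"
  shows "f = (\<lambda>y. \<Sum>v\<in>supp S K f. fval K f v * indicator (Yset K v) y)"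
proof
  fix y
  note K = adapted_number_field[OF f(2)]
  show "f y = (\<Sum>v\<in>supp S K f. fval K f v * indicator (Yset K v) y)"
  proof (cases "y \<in> Xset S")
    case True
    then obtain v where v: "v \<in> MK S K" "y \<in> Yset K v" using Xset_eq[OF K] by blast
    have "supp S K f \<subseteq> places K" using MK_place by (auto simp: supp_def)
    then have "(\<Sum>v\<in>supp S K f. fval K f v * indicator (Yset K v) y)
        = (if v \<in> supp S K f then fval K f v else 0)"
      by (rule sum_indicator_Yset[OF K adapted_finite[OF f(2)] _ MK_place[OF v(1)] v(2)])
    also have "\<dots> = f y"
      using fval_eq[OF f(2) v] v by (auto simp: supp_def)
    finally show ?thesis by simp
  next
    case False
    then have "y \<notin> Yset K v" if "v \<in> supp S K f" for v
      using that Yset_subset_Xset[OF K, of v] by (auto simp: supp_def)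
    then show ?thesis using LCc_outside[OF f(1) False] by simp
  qed
qed

lemma Phi_surj:
  assumes l: "l \<in> Lstar S"
  shows "\<exists>c\<in>Jstar S. Phi S c = l"
proof -
  \<comment> \<open>On \<open>Jset S\<close> the value is forced by \<open>Phi_indicator\<close>;
    elsewhere \<open>Jstar\<close> prescribes 0.\<close>
  define c where "c = (\<lambda>K v. if (K, v) \<in> Jset S then l (indicator (Yset K v)) else 0)"
  have c_eq: "c K v = l (indicator (Yset K v))" if "number_field K" "v \<in> MK S K" for K v
    using that by (simp add: c_def Jset_def)
  have "consistent S c"
    unfolding consistent_def
  proof (intro ballI, clarify)
    fix K v L assume "(K, v) \<in> Jset S" and L: "number_field L" "K \<subseteq> L"
    then have K: "number_field K" "v \<in> MK S K" by (auto simp: Jset_def)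
    let ?W = "{w \<in> places L. divides K w v}"
    have W: "w \<in> MK S L" if "w \<in> ?W" for w using that MK_above[OF K(1) L K(2)] by blast
    have "c K v = l (\<lambda>y. \<Sum>w\<in>?W. indicator (Yset L w) y)"
      using c_eq[OF K] indicator_Yset_decompose[OF K(1) L K(2)] by simp
    also have "\<dots> = (\<Sum>w\<in>?W. l (indicator (Yset L w)))"
      using W by (intro Lstar_sum[OF l] finite_places_above[OF K(1) L K(2)] indicator_LCc[OF L(1)])
    also have "\<dots> = (\<Sum>w\<in>?W. c L w)"
      using c_eq[OF L(1) W] by (intro sum.cong refl) simp
    finally show "c K v = (\<Sum>w\<in>?W. c L w)" .
  qed
  then have c: "c \<in> Jstar S" by (simp add: Jstar_def c_def)
  have "Phi S c f = l f" for f
  proof (cases "f \<in> LCc S")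
    case True
    then obtain K where f: "adapted S K f" using LCc_imp_adapted by blast
    note K = adapted_number_field[OF f]
    have MK: "v \<in> MK S K" if "v \<in> supp S K f" for v using that by (simp add: supp_def)
    have "l f = l (\<lambda>y. \<Sum>v\<in>supp S K f. fval K f v * indicator (Yset K v) y)"
      using adapted_eq_sum_indicator[OF True f] by (rule arg_cong)
    also have "\<dots> = (\<Sum>v\<in>supp S K f. l (\<lambda>y. fval K f v * indicator (Yset K v) y))"
      by (intro Lstar_sum[OF l] adapted_finite[OF f] LCc_scale indicator_LCc[OF K] MK)
    also have "\<dots> = (\<Sum>v\<in>supp S K f. c K v * fval K f v)"
      using Lstar_scale[OF l indicator_LCc[OF K MK]] c_eq[OF K MK]
      by (intro sum.cong refl) (simp add: mult.commute)
    also have "\<dots> = Phi S c f" unfolding Phi_eq[OF True f c] Phi_at_def by (rule refl)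
    finally show ?thesis by simp
  next
    case False
    then show ?thesis using Lstar_outside[OF l] by (simp add: Phi_def)
  qed
  then show ?thesis using c by (intro bexI[of _ c] ext)
qed

end

theorem theorem1p2:
  fixes S :: "place set"
  assumes "S \<subseteq> places \<rat>"
  shows "(\<forall>c\<in>Jstar S. \<forall>d\<in>Jstar S. Phi S (\<lambda>K v. c K v + d K v) = (\<lambda>f. Phi S c f + Phi S d f))
    \<and> (\<forall>a. \<forall>c\<in>Jstar S. Phi S (\<lambda>K v. a * c K v) = (\<lambda>f. a * Phi S c f))
    \<and> bij_betw (Phi S) (Jstar S) (Lstar S)"
proof (intro conjI ballI allI)
  show "bij_betw (Phi S) (Jstar S) (Lstar S)"
    unfolding bij_betw_def
  proof
    show "inj_on (Phi S) (Jstar S)" by (rule Phi_inj[OF assms])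
    show "Phi S ` Jstar S = Lstar S"
      using Phi_in_Lstar[OF assms] Phi_surj[OF assms] by auto
  qed
qed (simp_all add: Phi_add Phi_scale fun_eq_iff)

end
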